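(* Let $N\in\mathbb{N}$ and assume $\sup_{\theta\in\Theta}\mathbb{E}_\theta[X_1^+]<\infty$. In the Bayesian house selling problem with horizon $N$: a) An optimal stopping time, i.e. one attaining the supremum defining $J_N(x)$, is $$\tau^*=\inf\big\{n\in\{0,\dots,N-1\}: X_n\ge x_{n,N}^*(\mu_n(\cdot|h_n))\big\}\wedge N,\qquad h_n=(X_0,\dots,X_n),\ \inf\emptyset=\infty .$$ b) The reservation levels can recursively be computed, for all $\mu\in\mathbb{P}(\Theta)$, by $$x_{N-1,N}^*(\mu)=U_{N-1}^{-1}\Big(\int_{\mathbb{R}}U_N(x)\,Q(dx|\mu)\Big),$$ $$x_{n,N}^*(\mu)=U_n^{-1}\Big(\int_{\mathbb{R}}U_{n+1}\big(\max\{x,\ x_{n+1,N}^*(\Phi(x,\mu))\}\big)\,Q(dx|\mu)\Big),\qquad n=0,\dots,N-2.$$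
   Context: Bayesian house selling problem. $\Theta$ is a Borel space with $\mathbb{P}(\Theta)$ its set of probability measures. Given the unknown parameter $\theta\in\Theta$, offers are i.i.d. real random variables with distribution $Q_\theta$ having density $q(x|\theta)$ (jointly measurable) with respect to a $\sigma$-finite measure $\lambda$ on $\mathbb{R}$; $\theta$ has prior $Q_0\in\mathbb{P}(\Theta)$. The initial offer $X_0=x$ is a fixed known number; $X_1,X_2,\dots$ are the subsequent offers. $\mathbb{E}_{x\theta}$ is expectation given $X_0=x$ and parameter $\theta$; $\mathbb{E}_\theta[X_1^+]=\int x^+\,Q_\theta(dx)$. $c>0$ is the maintenance cost paid each time an offer is rejected, and $U:\mathbb{R}\to\mathbb{R}$ is strictly increasing and concave. With stopping times relative to $\mathcal{F}_n=\sigma(X_0,\dots,X_n)$, $$J_N(x):=\sup_{0\le\tau\le N}\int_\Theta\mathbb{E}_{x\theta}\big[U(X_\tau-c\tau)\big]\,Q_0(d\theta).$$ Notation: $Q(\cdot|\mu)=\int_\Theta Q_\theta(\cdot)\,\mu(d\theta)$. Updating operator: $\Phi(x,\mu)(B)=\dfrac{\int_B q(x|\theta)\,\mu(d\theta)}{\int_\Theta q(x|\theta)\,\mu(d\theta)}$ for $B\in\mathcal{B}(\Theta)$ (a fixed arbitrary probability measure if the denominator is not in $(0,\infty)$). Filter: $\mu_0=Q_0$, $\mu_{n+1}(\cdot|h_n,x')=\Phi(x',\mu_n(\cdot|h_n))$ for $h_n=(x_0,\dots,x_n)$. The value functions are $V_0(x,\mu,s)=U(x+s)$, $V_n(x,\mu,s)=\max\{U(x+s),c_n(\mu,s)\}$,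 where $c_n(\mu,s):=\int_{\mathbb{R}}V_{n-1}(x',\Phi(x',\mu),s-c)\,Q(dx'|\mu)$ for $n\ge1$, $\mu\in\mathbb{P}(\Theta)$, $s\in\mathbb{R}$. Put $U_n(x):=U(x-nc)$, so $U_n^{-1}(y)=nc+U^{-1}(y)$. The reservation levels are $$x_{n,N}^*(\mu):=U_n^{-1}\big(c_{N-n}(\mu,-nc)\big),\quad n=0,\dots,N-1,\ \mu\in\mathbb{P}(\Theta).$$ Integrals of utilities take values in $[-\infty,\infty)$; conventions $U(-\infty)=-\infty$, $U^{-1}(-\infty)=-\infty$. *)

theory Defs
  imports "HOL-Probability.Probability"
begin

text \<open>
  Parameters used throughout: \<open>lam\<close> is the dominating measure on the reals, \<open>q y \<theta>\<close> the density
  of an offer at \<open>y\<close> under parameter \<open>\<theta>\<close>, \<open>nu\<close> the default value of the updating operator, \<open>c\<close> the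
  maintenance cost, \<open>U\<close> the utility, \<open>Q0\<close> the prior, \<open>N\<close> the horizon. The set of probability
  measures on a Borel space \<open>\<Theta>\<close> (a Borel subset of a Polish space) is
  \<open>space (prob_algebra (restrict_space borel \<Theta>))\<close>.
\<close>

text \<open>
  Integral with values in the extended reals. It is meant for functions whose positive part has
  a finite integral; it then lies in $[-\infty,\infty)$.
\<close>

definition ext_integral :: "'a measure \<Rightarrow> ('a \<Rightarrow> ereal) \<Rightarrow> ereal" where
  "ext_integral M f =
     enn2ereal (\<integral>\<^sup>+ z. e2ennreal (f z) \<partial>M) - enn2ereal (\<integral>\<^sup>+ z. e2ennreal (- f z) \<partial>M)"

text \<open>
  Extensions of a function and of its inverse with the conventions \<open>f (-\<infinity>) = -\<infinity>\<close> and
  \<open>f\<^sup>-\<^sup>1 (-\<infinity>) = -\<infinity>\<close>. Arguments \<open>\<infinity>\<close>, and for the inverse also reals outside \<open>range f\<close>, have no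
  meaning.
\<close>

definition ext_fun :: "(real \<Rightarrow> real) \<Rightarrow> ereal \<Rightarrow> ereal" where
  "ext_fun f z = (if z = -\<infinity> then -\<infinity> else ereal (f (real_of_ereal z)))"

definition ext_inv :: "(real \<Rightarrow> real) \<Rightarrow> ereal \<Rightarrow> ereal" where
  "ext_inv f y = (if y = -\<infinity> then -\<infinity> else ereal (inv f (real_of_ereal y)))"

definition offer_dist :: "real measure \<Rightarrow> (real \<Rightarrow> 't \<Rightarrow> real) \<Rightarrow> 't \<Rightarrow> real measure" where
  "offer_dist lam q \<theta> = density lam (\<lambda>y. ennreal (q y \<theta>))"

definition mix_dist :: "real measure \<Rightarrow> (real \<Rightarrow> 't \<Rightarrow> real) \<Rightarrow> 't measure \<Rightarrow> real measure" where
  "mix_dist lam q \<mu> = \<mu> \<bind> offer_dist lam q"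

definition update ::
  "(real \<Rightarrow> 't \<Rightarrow> real) \<Rightarrow> 't measure \<Rightarrow> real \<Rightarrow> 't measure \<Rightarrow> 't measure" where
  "update q nu y \<mu> =
     (let D = \<integral>\<^sup>+ \<theta>. ennreal (q y \<theta>) \<partial>\<mu>
      in if 0 < D \<and> D < \<infinity> then scale_measure (1 / D) (density \<mu> (\<lambda>\<theta>. ennreal (q y \<theta>))) else nu)"

text \<open>The filter at time \<open>n\<close>; a history is a whole path \<open>h\<close>, of which only \<open>h 0, \<dots>, h n\<close> matter.\<close>

primrec posterior ::
  "(real \<Rightarrow> 't \<Rightarrow> real) \<Rightarrow> 't measure \<Rightarrow> 't measure \<Rightarrow> nat \<Rightarrow> (nat \<Rightarrow> real) \<Rightarrow> 't measure" where
  "posterior q nu Q0 0 h = Q0"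
| "posterior q nu Q0 (Suc n) h = update q nu (h (Suc n)) (posterior q nu Q0 n h)"

definition next_value ::
  "real measure \<Rightarrow> (real \<Rightarrow> 't \<Rightarrow> real) \<Rightarrow> 't measure \<Rightarrow> real \<Rightarrow>
    (real \<Rightarrow> 't measure \<Rightarrow> real \<Rightarrow> ereal) \<Rightarrow> 't measure \<Rightarrow> real \<Rightarrow> ereal" where
  "next_value lam q nu c W \<mu> s =
     ext_integral (mix_dist lam q \<mu>) (\<lambda>y. W y (update q nu y \<mu>) (s - c))"

primrec val ::
  "real measure \<Rightarrow> (real \<Rightarrow> 't \<Rightarrow> real) \<Rightarrow> 't measure \<Rightarrow> real \<Rightarrow> (real \<Rightarrow> real) \<Rightarrow>
    nat \<Rightarrow> real \<Rightarrow> 't measure \<Rightarrow> real \<Rightarrow> ereal" where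
  "val lam q nu c U 0 = (\<lambda>x \<mu> s. ereal (U (x + s)))"
| "val lam q nu c U (Suc n) =
     (\<lambda>x \<mu> s. max (ereal (U (x + s))) (next_value lam q nu c (val lam q nu c U n) \<mu> s))"

text \<open>The continuation value $c_n(\mu,s)$, meaningful for $n \ge 1$ only.\<close>

definition cont_val ::
  "real measure \<Rightarrow> (real \<Rightarrow> 't \<Rightarrow> real) \<Rightarrow> 't measure \<Rightarrow> real \<Rightarrow> (real \<Rightarrow> real) \<Rightarrow>
    nat \<Rightarrow> 't measure \<Rightarrow> real \<Rightarrow> ereal" where
  "cont_val lam q nu c U n = next_value lam q nu c (val lam q nu c U (n - 1))"

definition shifted_util :: "real \<Rightarrow> (real \<Rightarrow> real) \<Rightarrow> nat \<Rightarrow> real \<Rightarrow> real" where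
  "shifted_util c U n x = U (x - real n * c)"

definition res_level ::
  "real measure \<Rightarrow> (real \<Rightarrow> 't \<Rightarrow> real) \<Rightarrow> 't measure \<Rightarrow> real \<Rightarrow> (real \<Rightarrow> real) \<Rightarrow>
    nat \<Rightarrow> nat \<Rightarrow> 't measure \<Rightarrow> ereal" where
  "res_level lam q nu c U N n \<mu> =
     ext_inv (shifted_util c U n) (cont_val lam q nu c U (N - n) \<mu> (- (real n * c)))"

text \<open>
  Canonical model: a sample point is the path of offers, \<open>X n \<omega> = \<omega> n\<close>. Given \<open>X 0 = x\<close> and the
  parameter \<open>\<theta>\<close>, the offers from time 1 on are i.i.d.
\<close>

definition path_measure ::
  "real measure \<Rightarrow> (real \<Rightarrow> 't \<Rightarrow> real) \<Rightarrow> real \<Rightarrow> 't \<Rightarrow> (nat \<Rightarrow> real) measure" where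
  "path_measure lam q x \<theta> =
     (\<Pi>\<^sub>M n\<in>UNIV. if n = 0 then return borel x else offer_dist lam q \<theta>)"

definition offer_filtration :: "nat \<Rightarrow> (nat \<Rightarrow> real) measure" where
  "offer_filtration n = sigma UNIV {{\<omega>. \<omega> i \<in> B} |i B. i \<le> n \<and> B \<in> sets borel}"

definition stopping_times :: "nat \<Rightarrow> ((nat \<Rightarrow> real) \<Rightarrow> nat) set" where
  "stopping_times N = {\<tau>. stopping_time offer_filtration \<tau> \<and> (\<forall>\<omega>. \<tau> \<omega> \<le> N)}"

definition reward ::
  "real measure \<Rightarrow> (real \<Rightarrow> 't \<Rightarrow> real) \<Rightarrow> real \<Rightarrow> (real \<Rightarrow> real) \<Rightarrow> 't measure \<Rightarrow>
    real \<Rightarrow> ((nat \<Rightarrow> real) \<Rightarrow> nat) \<Rightarrow> ereal" where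
  "reward lam q c U Q0 x \<tau> =
     ext_integral Q0 (\<lambda>\<theta>. ext_integral (path_measure lam q x \<theta>)
       (\<lambda>\<omega>. ereal (U (\<omega> (\<tau> \<omega>) - c * real (\<tau> \<omega>)))))"

definition opt_reward ::
  "real measure \<Rightarrow> (real \<Rightarrow> 't \<Rightarrow> real) \<Rightarrow> real \<Rightarrow> (real \<Rightarrow> real) \<Rightarrow> 't measure \<Rightarrow>
    nat \<Rightarrow> real \<Rightarrow> ereal" where
  "opt_reward lam q c U Q0 N x = (SUP \<tau>\<in>stopping_times N. reward lam q c U Q0 x \<tau>)"

text \<open>
  Inserting \<open>N\<close> into the set renders both the cap at \<open>N\<close> and the convention that the
  infimum of the empty set is infinite (on \<open>nat\<close>, \<open>Inf {} = 0\<close>).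
\<close>

definition opt_stop ::
  "real measure \<Rightarrow> (real \<Rightarrow> 't \<Rightarrow> real) \<Rightarrow> 't measure \<Rightarrow> real \<Rightarrow> (real \<Rightarrow> real) \<Rightarrow>
    't measure \<Rightarrow> nat \<Rightarrow> (nat \<Rightarrow> real) \<Rightarrow> nat" where
  "opt_stop lam q nu c U Q0 N \<omega> =
     Inf (insert N {n. n < N \<and>
       ereal (\<omega> n) \<ge> res_level lam q nu c U N n (posterior q nu Q0 n \<omega>)})"

end

theory Submission
  imports Defs
begin

text \<open>
  Mixing the path laws over the parameter turns the problem into a Markov decision problem whose
  state is the current offer \<open>x\<close>, the current belief \<open>\<mu>\<close> about the parameter, and the cost \<open>- s\<close>
  paid so far. Write \<open>path_mix x \<mu>\<close> for the law of the offer path when the first offer is \<open>x\<close> and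
  the parameter is drawn from \<open>\<mu>\<close>. Bayes' rule (\<open>bayes_bind\<close>) says that drawing a parameter from
  \<open>\<mu>\<close> and then an offer \<open>y\<close> from its distribution amounts to drawing \<open>y\<close> from the mixture
  \<open>mix_dist \<mu>\<close> and then the parameter from the posterior \<open>update y \<mu>\<close>. Hence, after the first
  offer, the path under \<open>path_mix x \<mu>\<close> is a path under \<open>path_mix y (update y \<mu>)\<close> with \<open>y\<close> drawn
  from \<open>mix_dist \<mu>\<close> (\<open>path_mix_step\<close>); this is the Markov property of the pair of offer and belief.

  Optimality is then backward induction on the horizon. A stopping time decides at time 0 from the
  first offer alone, so on the paths that start with a given \<open>x\<close> it either stops everywhere or
  continues everywhere. If it continues, dropping the first offer leaves a stopping time for a
  horizon shorter by one, and its value is the \<open>mix_dist \<mu>\<close>-mean of the values of that shorter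
  problem (\<open>value_of_continue\<close>). So no stopping time beats the value function
  (\<open>value_of_le_val\<close>), and the rule that stops as soon as the utility in hand reaches the
  continuation value attains it (\<open>value_of_waiting_rule\<close>).

  Concavity of the utility supplies two things. The utility grows at most linearly, so the bound on
  the mean positive parts of the offers makes the positive part of every payoff integrable, and
  iterated integrals with values in $[-\infty,\infty)$ behave like ordinary ones
  (\<open>ext_integral_bind\<close>). The utility is also continuous, so its range is an interval, and a
  continuation value, being a mean of utilities, is again a utility or \<open>-\<infinity>\<close>
  (\<open>ext_integral_mean_value\<close>, \<open>val_cont_range\<close>). It therefore has a preimage, and comparing
  utilities with continuation values is the same as comparing offers with reservation levels. The
  same preimage turns \<open>max {U y, c}\<close> into \<open>U (max {y, U\<^sup>-\<^sup>1 c})\<close>, which is the recursion for the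
  levels.
\<close>

section \<open>Integrals with values in the extended reals\<close>

lemma ext_integral_mono:
  assumes "\<And>z. z \<in> space M \<Longrightarrow> f z \<le> g z"
  shows "ext_integral M f \<le> ext_integral M g"
  unfolding ext_integral_def
  using assms
  by (intro ereal_minus_mono; simp flip: less_eq_ennreal.rep_eq)
    (auto intro!: nn_integral_mono e2ennreal_mono)

lemma ext_integral_cong:
  assumes "\<And>z. z \<in> space M \<Longrightarrow> f z = g z"
  shows "ext_integral M f = ext_integral M g"
  unfolding ext_integral_def using assms by (auto cong: nn_integral_cong)

lemma ext_integral_const:
  assumes "prob_space M"
  shows "ext_integral M (\<lambda>_. k) = k"
  using prob_space.emeasure_space_1[OF assms]
  by (cases k; cases "0 \<le> k") (auto simp: ext_integral_def e2ennreal_neg ennreal_neg zero_ennreal.rep_eq)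

lemma ext_integral_distr:
  assumes "T \<in> M \<rightarrow>\<^sub>M N" "f \<in> borel_measurable N"
  shows "ext_integral (distr M N T) f = ext_integral M (\<lambda>z. f (T z))"
  using assms by (simp add: ext_integral_def nn_integral_distr)

lemma borel_measurable_ext_integral:
  assumes f: "(\<lambda>(x, y). f x y) \<in> borel_measurable (M \<Otimes>\<^sub>M N)"
    and L: "L \<in> M \<rightarrow>\<^sub>M prob_algebra N"
  shows "(\<lambda>x. ext_integral (L x) (f x)) \<in> borel_measurable M"
proof -
  note [measurable] = f measurable_prob_algebraD[OF L]
  have [measurable]: "(\<lambda>x. \<integral>\<^sup>+ y. e2ennreal (f x y) \<partial>L x) \<in> borel_measurable M"
    "(\<lambda>x. \<integral>\<^sup>+ y. e2ennreal (- f x y) \<partial>L x) \<in> borel_measurable M"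
    by (rule nn_integral_measurable_subprob_algebra2, measurable)+
  show ?thesis
    unfolding ext_integral_def by measurable
qed

text \<open>
  The two sides differ only in where cancellation takes place. Pointwise, the positive and the
  negative part of \<open>P - L\<close> satisfy \<open>(P - L)\<^sup>+ + L = (P - L)\<^sup>- + P\<close> wherever \<open>P\<close> is finite, and
  this identity survives integration; finiteness of the integral of \<open>P\<close> then allows to
  subtract. The integral of \<open>L\<close> may be infinite, in which case both sides are \<open>-\<infinity>\<close>.
\<close>

lemma ext_integral_diff:
  assumes P[measurable]: "P \<in> borel_measurable M" and L[measurable]: "L \<in> borel_measurable M"
    and fin: "(\<integral>\<^sup>+ x. P x \<partial>M) < \<infinity>"
  shows "ext_integral M (\<lambda>x. enn2ereal (P x) - enn2ereal (L x)) =
    enn2ereal (\<integral>\<^sup>+ x. P x \<partial>M) - enn2ereal (\<integral>\<^sup>+ x. L x \<partial>M)"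
proof -
  define A where "A x = e2ennreal (enn2ereal (P x) - enn2ereal (L x))" for x
  define B where "B x = e2ennreal (- (enn2ereal (P x) - enn2ereal (L x)))" for x
  have [measurable]: "A \<in> borel_measurable M" "B \<in> borel_measurable M"
    unfolding A_def B_def by measurable
  have AE_P: "AE x in M. P x \<noteq> \<infinity>"
    using fin by (intro nn_integral_noteq_infinite) auto
  have AP: "AE x in M. A x \<le> P x" and AB: "AE x in M. A x + L x = B x + P x"
  proof -
    have *: "a \<le> p \<and> a + l = b + p" if "p \<noteq> \<infinity>" "a = e2ennreal (enn2ereal p - enn2ereal l)"
      "b = e2ennreal (- (enn2ereal p - enn2ereal l))" for a b p l :: ennreal
    proof (cases p)
      case p: (real r)
      show ?thesis
      proof (cases l)
        case l: (real t)
        show ?thesis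
          using p l that by (cases "t \<le> r")
            (auto simp: ennreal_neg simp flip: ennreal_plus intro!: ennreal_leI)
      next
        case top
        then show ?thesis using p that by (simp add: e2ennreal_neg)
      qed
    qed (use that in auto)
    show "AE x in M. A x \<le> P x" "AE x in M. A x + L x = B x + P x"
      using AE_P by (eventually_elim, use * A_def B_def in blast)+
  qed
  have Afin: "(\<integral>\<^sup>+ x. A x \<partial>M) < \<infinity>"
    using nn_integral_mono_AE[OF AP] fin by (rule le_less_trans)
  have sum: "(\<integral>\<^sup>+ x. A x \<partial>M) + (\<integral>\<^sup>+ x. L x \<partial>M) = (\<integral>\<^sup>+ x. B x \<partial>M) + (\<integral>\<^sup>+ x. P x \<partial>M)"
    using nn_integral_cong_AE[OF AB] by (simp add: nn_integral_add)
  have "enn2ereal a - enn2ereal b = enn2ereal p - enn2ereal l"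
    if "a < \<infinity>" "p < \<infinity>" "a + l = b + p" for a b p l :: ennreal
    using that
    by (cases a; cases b; cases p; cases l) (auto simp flip: ennreal_plus)
  from this[OF Afin fin sum] show ?thesis
    by (simp add: ext_integral_def A_def B_def)
qed

text \<open>
  The tower property. Finiteness of the positive part is what rules out \<open>\<infinity> - \<infinity>\<close>, both for
  the joint integral and for almost every inner one.
\<close>

lemma ext_integral_bind:
  assumes L: "L \<in> M \<rightarrow>\<^sub>M subprob_algebra N" and f[measurable]: "f \<in> borel_measurable N"
    and fin: "(\<integral>\<^sup>+ z. e2ennreal (f z) \<partial>(M \<bind> L)) < \<infinity>"
  shows "ext_integral (M \<bind> L) f = ext_integral M (\<lambda>x. ext_integral (L x) f)"
proof -
  note [measurable] = L nn_integral_measurable_subprob_algebra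
  have *: "(\<integral>\<^sup>+ z. e2ennreal (f z) \<partial>(M \<bind> L)) = (\<integral>\<^sup>+ x. \<integral>\<^sup>+ z. e2ennreal (f z) \<partial>L x \<partial>M)"
    "(\<integral>\<^sup>+ z. e2ennreal (- f z) \<partial>(M \<bind> L)) = (\<integral>\<^sup>+ x. \<integral>\<^sup>+ z. e2ennreal (- f z) \<partial>L x \<partial>M)"
    by (rule nn_integral_bind[OF _ L]; measurable)+
  have [measurable]: "(\<lambda>x. \<integral>\<^sup>+ z. e2ennreal (f z) \<partial>L x) \<in> borel_measurable M"
    "(\<lambda>x. \<integral>\<^sup>+ z. e2ennreal (- f z) \<partial>L x) \<in> borel_measurable M"
    by (rule measurable_compose[OF L]; measurable)+
  show ?thesis
    using ext_integral_diff[of "\<lambda>x. \<integral>\<^sup>+ z. e2ennreal (f z) \<partial>L x" M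
        "\<lambda>x. \<integral>\<^sup>+ z. e2ennreal (- f z) \<partial>L x"] fin
    by (simp add: * ext_integral_def[of "M \<bind> L"] ext_integral_def[of "L _"])
qed

text \<open>
  A mean of values from an interval lies in that interval, even when the interval is open: were
  all of its points strictly on one side of the mean, the mean would lie strictly on that side of
  itself. The value \<open>-\<infinity>\<close> is left for an infinite negative part.
\<close>

lemma ext_integral_mean_value:
  assumes M: "prob_space M" and h[measurable]: "h \<in> borel_measurable M"
    and h_eq: "\<And>z. z \<in> space M \<Longrightarrow> h z \<in> ereal ` range U"
    and U: "continuous_on UNIV (U :: real \<Rightarrow> real)"
    and fin: "(\<integral>\<^sup>+ z. e2ennreal (h z) \<partial>M) < \<infinity>"
  shows "ext_integral M h \<in> insert (-\<infinity>) (ereal ` range U)"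
proof (cases "(\<integral>\<^sup>+ z. e2ennreal (- h z) \<partial>M) = \<infinity>")
  case True
  then show ?thesis
    using fin by (cases "\<integral>\<^sup>+ z. e2ennreal (h z) \<partial>M") (auto simp: ext_integral_def)
next
  case False
  interpret prob_space M by fact
  define g where "g z = real_of_ereal (h z)" for z
  have g_meas[measurable]: "g \<in> borel_measurable M"
    unfolding g_def by measurable
  have hg: "h z = ereal (g z)" and gU: "g z \<in> range U" if "z \<in> space M" for z
    using h_eq[OF that] by (auto simp: g_def)
  have nn: "(\<integral>\<^sup>+ z. e2ennreal (h z) \<partial>M) = (\<integral>\<^sup>+ z. ennreal (g z) \<partial>M)"
    "(\<integral>\<^sup>+ z. e2ennreal (- h z) \<partial>M) = (\<integral>\<^sup>+ z. ennreal (- g z) \<partial>M)"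
    by (intro nn_integral_cong; simp add: hg)+
  have int: "integrable M g"
    using fin False by (simp add: real_integrable_def nn)
  define I where "I = expectation g"
  have ext: "ext_integral M h = ereal I"
    using fin False
    unfolding I_def real_lebesgue_integral_def[OF int] ext_integral_def nn
    by (cases "\<integral>\<^sup>+ z. ennreal (g z) \<partial>M"; cases "\<integral>\<^sup>+ z. ennreal (- g z) \<partial>M") auto
  have "\<exists>a. U a \<le> I"
  proof (rule ccontr)
    assume "\<not> (\<exists>a. U a \<le> I)"
    then have "AE z in M. I < g z"
      using gU by (force simp: not_le)
    from expectation_greater[OF int this] show False by (simp add: I_def)
  qed
  moreover have "\<exists>b. I \<le> U b"
  proof (rule ccontr)
    assume "\<not> (\<exists>b. I \<le> U b)"
    then have "AE z in M. g z < I"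
      using gU by (force simp: not_le)
    from expectation_less[OF int this] show False by (simp add: I_def)
  qed
  ultimately obtain a b where ab: "U a \<le> I" "I \<le> U b" by blast
  have "connected (range U)"
    using U by (intro connected_continuous_image) auto
  then have "I \<in> range U"
    by (rule connectedD_interval[OF _ _ _ ab]) auto
  then show ?thesis by (auto simp: ext)
qed

lemma e2ennreal_ext_integral_le:
  "e2ennreal (ext_integral M f) \<le> (\<integral>\<^sup>+ z. e2ennreal (f z) \<partial>M)"
proof -
  have "enn2ereal a - enn2ereal b \<le> enn2ereal a" for a b
    by (cases a; cases b) auto
  from e2ennreal_mono[OF this] show ?thesis
    unfolding ext_integral_def by simp
qed

text \<open>
  Why a comparison of utilities is a comparison of offers with a level: on \<open>-\<infinity>\<close> and the range
  of \<open>f\<close>, the extended inverse is a genuine order-preserving inverse.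
\<close>

lemma ext_inv_le_iff:
  fixes f :: "real \<Rightarrow> real"
  assumes f: "strict_mono f" and z: "z \<in> insert (-\<infinity>) (ereal ` range f)"
  shows "ext_inv f z \<le> ereal x \<longleftrightarrow> z \<le> ereal (f x)"
proof (cases "z = -\<infinity>")
  case False
  then obtain w where "z = ereal (f w)" using z by auto
  then show ?thesis
    using strict_mono_imp_inj_on[OF f] by (simp add: ext_inv_def strict_mono_less_eq[OF f])
qed (simp add: ext_inv_def)

lemma ext_fun_max_ext_inv:
  fixes f :: "real \<Rightarrow> real"
  assumes f: "strict_mono f" and z: "z \<in> insert (-\<infinity>) (ereal ` range f)"
  shows "ext_fun f (max (ereal x) (ext_inv f z)) = max (ereal (f x)) z"
proof (cases "z = -\<infinity>")
  case False
  then obtain w where "z = ereal (f w)" using z by auto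
  then show ?thesis
    using strict_mono_imp_inj_on[OF f]
    by (simp add: ext_inv_def ext_fun_def max_def strict_mono_less_eq[OF f])
qed (simp add: ext_inv_def ext_fun_def)

section \<open>Beliefs and Bayes' rule\<close>

text \<open>
  Offers and beliefs without costs and utilities, so that the Markov property of offer and
  belief can be established as a statement about probability laws alone.
\<close>

locale bayes_model =
  fixes T :: "'t measure" and lam :: "real measure" and q :: "real \<Rightarrow> 't \<Rightarrow> real"
    and nu :: "'t measure"
  assumes sets_lam[measurable_cong]: "sets lam = sets borel"
    and sigma_finite_lam: "sigma_finite_measure lam"
    and q_measurable: "(\<lambda>(y, \<theta>). q y \<theta>) \<in> borel_measurable (borel \<Otimes>\<^sub>M T)"
    and prob_offer: "\<And>\<theta>. \<theta> \<in> space T \<Longrightarrow> prob_space (offer_dist lam q \<theta>)"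
    and nu: "nu \<in> space (prob_algebra T)"
begin

sublocale lam: sigma_finite_measure lam
  by (rule sigma_finite_lam)

lemma measurable_q[measurable (raw)]:
  "f \<in> M \<rightarrow>\<^sub>M borel \<Longrightarrow> g \<in> M \<rightarrow>\<^sub>M T \<Longrightarrow> (\<lambda>x. q (f x) (g x)) \<in> borel_measurable M"
  using measurable_compose[OF measurable_Pair q_measurable, of f M g] by simp

lemma space_lam[simp]: "space lam = UNIV"
  using sets_eq_imp_space_eq[OF sets_lam] by simp

lemma offer_measurable[measurable]: "offer_dist lam q \<in> T \<rightarrow>\<^sub>M prob_algebra borel"
proof (rule measurable_prob_algebraI[OF prob_offer])
  show "offer_dist lam q \<in> T \<rightarrow>\<^sub>M subprob_algebra borel"
  proof (rule measurable_subprob_algebra)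
    fix A :: "real set" assume A[measurable]: "A \<in> sets borel"
    have "(\<lambda>\<theta>. \<integral>\<^sup>+ y. ennreal (q y \<theta>) * indicator A y \<partial>lam) \<in> borel_measurable T"
      by measurable
    then show "(\<lambda>\<theta>. emeasure (offer_dist lam q \<theta>) A) \<in> borel_measurable T"
      by (subst measurable_cong) (auto simp: offer_dist_def emeasure_density sets_lam)
  next
    fix \<theta> assume "\<theta> \<in> space T"
    then show "subprob_space (offer_dist lam q \<theta>)"
      by (intro prob_space_imp_subprob_space prob_offer)
  qed (simp add: offer_dist_def sets_lam)
qed

lemma mix_measurable[measurable]: "mix_dist lam q \<in> prob_algebra T \<rightarrow>\<^sub>M prob_algebra borel"
  unfolding mix_dist_def by measurable

lemma mix_dist_prob:
  assumes "\<mu> \<in> space (prob_algebra T)"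
  shows "prob_space (mix_dist lam q \<mu>)" "sets (mix_dist lam q \<mu>) = sets borel"
    "space (mix_dist lam q \<mu>) = UNIV"
  using measurable_space[OF mix_measurable assms]
  by (auto simp: space_prob_algebra dest: sets_eq_imp_space_eq)

text \<open>
  The marginal density of an offer at \<open>y\<close>; it is the density of the mixture with respect to
  \<open>lam\<close> (\<open>nn_integral_mix\<close>) and the denominator of the updating operator.
\<close>

definition evidence :: "real \<Rightarrow> 't measure \<Rightarrow> ennreal" where
  "evidence y \<mu> = (\<integral>\<^sup>+ \<theta>. ennreal (q y \<theta>) \<partial>\<mu>)"

lemma update_evidence:
  "update q nu y \<mu> = (if 0 < evidence y \<mu> \<and> evidence y \<mu> < \<infinity>
    then scale_measure (1 / evidence y \<mu>) (density \<mu> (\<lambda>\<theta>. ennreal (q y \<theta>))) else nu)"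
  by (simp add: update_def evidence_def Let_def)

lemma evidence_measurable[measurable (raw)]:
  assumes "f \<in> M \<rightarrow>\<^sub>M borel" and L[measurable]: "L \<in> M \<rightarrow>\<^sub>M prob_algebra T"
  shows "(\<lambda>x. evidence (f x) (L x)) \<in> borel_measurable M"
  unfolding evidence_def
  by (rule nn_integral_measurable_subprob_algebra2[OF _ measurable_prob_algebraD[OF L]]) (use assms in measurable)

lemma nn_integral_update:
  assumes \<mu>: "\<mu> \<in> space (prob_algebra T)" and f[measurable]: "f \<in> borel_measurable T"
    and "0 < evidence y \<mu>" "evidence y \<mu> < \<infinity>"
  shows "(\<integral>\<^sup>+ \<theta>. f \<theta> \<partial>update q nu y \<mu>) = (\<integral>\<^sup>+ \<theta>. ennreal (q y \<theta>) * f \<theta> \<partial>\<mu>) / evidence y \<mu>"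
proof -
  have [measurable_cong]: "sets \<mu> = sets T" using \<mu> by (simp add: space_prob_algebra)
  show ?thesis
    using assms(3,4)
    by (simp add: update_evidence nn_integral_scale_measure nn_integral_density divide_ennreal_def mult.commute)
qed

lemma update_prob:
  assumes \<mu>: "\<mu> \<in> space (prob_algebra T)"
  shows "update q nu y \<mu> \<in> space (prob_algebra T)"
proof (cases "0 < evidence y \<mu> \<and> evidence y \<mu> < \<infinity>")
  case True
  have s[measurable_cong]: "sets \<mu> = sets T" using \<mu> by (simp add: space_prob_algebra)
  have "emeasure (update q nu y \<mu>) (space (update q nu y \<mu>)) = 1"
    using nn_integral_update[OF \<mu>, of "\<lambda>_. 1" y] True
    by (simp add: evidence_def[symmetric]) (metis ennreal_divide_self less_irrefl)
  moreover have "sets (update q nu y \<mu>) = sets T"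
    using True s by (simp add: update_evidence)
  ultimately show ?thesis
    by (auto simp: space_prob_algebra intro!: prob_spaceI)
next
  case False
  then show ?thesis by (auto simp: update_evidence nu)
qed

text \<open>
  Joint measurability in observation and belief is needed to integrate over the next belief and
  to see that decisions based on the filter are adapted.
\<close>

lemma update_measurable:
  "(\<lambda>(y, \<mu>). update q nu y \<mu>) \<in> borel \<Otimes>\<^sub>M prob_algebra T \<rightarrow>\<^sub>M prob_algebra T"
proof (rule measurable_prob_algebraI)
  let ?M = "borel \<Otimes>\<^sub>M prob_algebra T :: (real \<times> 't measure) measure"
  have up: "update q nu (fst z) (snd z) \<in> space (prob_algebra T)" if "z \<in> space ?M" for z
    using that by (intro update_prob) (auto simp: space_pair_measure)
  show "prob_space (case z of (y, \<mu>) \<Rightarrow> update q nu y \<mu>)" if "z \<in> space ?M" for z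
    using up[OF that] by (simp add: space_prob_algebra split_beta)
  show "(\<lambda>(y, \<mu>). update q nu y \<mu>) \<in> ?M \<rightarrow>\<^sub>M subprob_algebra T"
  proof (rule measurable_subprob_algebra)
    fix A assume A[measurable]: "A \<in> sets T"
    have L: "snd \<in> ?M \<rightarrow>\<^sub>M subprob_algebra T"
      by (rule measurable_prob_algebraD) measurable
    have [measurable]: "(\<lambda>z. \<integral>\<^sup>+ \<theta>. ennreal (q (fst z) \<theta>) * indicator A \<theta> \<partial>snd z) \<in> borel_measurable ?M"
      by (rule nn_integral_measurable_subprob_algebra2[OF _ L]) measurable
    have eq: "emeasure (update q nu (fst z) (snd z)) A =
      (if 0 < evidence (fst z) (snd z) \<and> evidence (fst z) (snd z) < \<infinity>
       then (\<integral>\<^sup>+ \<theta>. ennreal (q (fst z) \<theta>) * indicator A \<theta> \<partial>snd z) / evidence (fst z) (snd z)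
       else emeasure nu A)" if "z \<in> space ?M" for z
    proof -
      have "sets (update q nu (fst z) (snd z)) = sets T"
        using up[OF that] by (simp add: space_prob_algebra)
      moreover have "snd z \<in> space (prob_algebra T)"
        using that by (auto simp: space_pair_measure)
      ultimately have A': "A \<in> sets (update q nu (fst z) (snd z))" and \<mu>: "snd z \<in> space (prob_algebra T)"
        using A by auto
      show ?thesis
      proof (cases "0 < evidence (fst z) (snd z) \<and> evidence (fst z) (snd z) < \<infinity>")
        case True
        then show ?thesis
          using nn_integral_update[OF \<mu> borel_measurable_indicator[OF A], of "fst z"]
          by (simp only: nn_integral_indicator[OF A'] if_True simp_thms)
      next
        case False
        then show ?thesis by (simp only: update_evidence if_False)
      qed
    qed
    show "(\<lambda>z. emeasure (case z of (y, \<mu>) \<Rightarrow> update q nu y \<mu>) A) \<in> borel_measurable ?M"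
      unfolding split_beta by (subst measurable_cong[OF eq]) measurable
  qed (use up in \<open>auto simp: space_prob_algebra split_beta prob_space_imp_subprob_space\<close>)
qed

lemma measurable_update[measurable (raw)]:
  "f \<in> M \<rightarrow>\<^sub>M borel \<Longrightarrow> L \<in> M \<rightarrow>\<^sub>M prob_algebra T \<Longrightarrow>
    (\<lambda>x. update q nu (f x) (L x)) \<in> M \<rightarrow>\<^sub>M prob_algebra T"
  using measurable_compose[OF measurable_Pair update_measurable, of f M L] by simp

lemma nn_integral_offer:
  assumes "\<theta> \<in> space T" and [measurable]: "f \<in> borel_measurable borel"
  shows "(\<integral>\<^sup>+ y. f y \<partial>offer_dist lam q \<theta>) = (\<integral>\<^sup>+ y. ennreal (q y \<theta>) * f y \<partial>lam)"
  using assms(1) unfolding offer_dist_def by (intro nn_integral_density) measurable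

lemma nn_integral_mix:
  assumes \<mu>: "\<mu> \<in> space (prob_algebra T)" and f[measurable]: "f \<in> borel_measurable borel"
  shows "(\<integral>\<^sup>+ y. f y \<partial>mix_dist lam q \<mu>) = (\<integral>\<^sup>+ y. evidence y \<mu> * f y \<partial>lam)"
proof -
  have s[measurable_cong]: "sets \<mu> = sets T" and "prob_space \<mu>"
    using \<mu> by (auto simp: space_prob_algebra)
  interpret \<mu>: prob_space \<mu> by fact
  interpret pair_sigma_finite lam \<mu> ..
  have "(\<integral>\<^sup>+ y. f y \<partial>mix_dist lam q \<mu>) = (\<integral>\<^sup>+ \<theta>. \<integral>\<^sup>+ y. f y \<partial>offer_dist lam q \<theta> \<partial>\<mu>)"
    unfolding mix_dist_def
    by (rule nn_integral_bind[OF f]) (use measurable_prob_algebraD[OF offer_measurable] s in \<open>simp cong: measurable_cong_sets\<close>)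
  also have "\<dots> = (\<integral>\<^sup>+ \<theta>. \<integral>\<^sup>+ y. ennreal (q y \<theta>) * f y \<partial>lam \<partial>\<mu>)"
    by (intro nn_integral_cong nn_integral_offer f) (simp flip: sets_eq_imp_space_eq[OF s])
  also have "\<dots> = (\<integral>\<^sup>+ y. \<integral>\<^sup>+ \<theta>. ennreal (q y \<theta>) * f y \<partial>\<mu> \<partial>lam)"
    by (rule Fubini') measurable
  also have "\<dots> = (\<integral>\<^sup>+ y. evidence y \<mu> * f y \<partial>lam)"
    unfolding evidence_def by (intro nn_integral_cong nn_integral_multc) measurable
  finally show ?thesis .
qed

text \<open>
  After interchanging the integrals, the claim compares densities with respect to \<open>lam\<close>: the
  posterior is the joint density divided by the evidence, and the mixture multiplies by the
  evidence again. Observations with zero evidence contribute nothing to either side, and those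
  with infinite evidence form a \<open>lam\<close>-null set because the evidence integrates to 1.
\<close>

lemma bayes_formula:
  assumes \<mu>: "\<mu> \<in> space (prob_algebra T)"
    and f[measurable]: "(\<lambda>(y, \<theta>). f y \<theta>) \<in> borel_measurable (borel \<Otimes>\<^sub>M T)"
  shows "(\<integral>\<^sup>+ \<theta>. \<integral>\<^sup>+ y. f y \<theta> \<partial>offer_dist lam q \<theta> \<partial>\<mu>) =
    (\<integral>\<^sup>+ y. \<integral>\<^sup>+ \<theta>. f y \<theta> \<partial>update q nu y \<mu> \<partial>mix_dist lam q \<mu>)"
proof -
  have s[measurable_cong]: "sets \<mu> = sets T" and "prob_space \<mu>"
    using \<mu> by (auto simp: space_prob_algebra)
  interpret \<mu>: prob_space \<mu> by fact
  interpret pair_sigma_finite lam \<mu> ..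
  have \<mu>c[measurable]: "(\<lambda>y::real. \<mu>) \<in> borel \<rightarrow>\<^sub>M prob_algebra T" "(\<lambda>y. \<mu>) \<in> lam \<rightarrow>\<^sub>M prob_algebra T"
    using \<mu> by auto
  have "(\<integral>\<^sup>+ y. evidence y \<mu> * 1 \<partial>lam) = 1"
    using nn_integral_mix[OF \<mu>, of "\<lambda>_. 1"] prob_space.emeasure_space_1[OF mix_dist_prob(1)[OF \<mu>]]
    by simp
  then have fin: "AE y in lam. evidence y \<mu> \<noteq> \<infinity>"
    by (intro nn_integral_noteq_infinite) auto
  have [measurable]: "(\<lambda>y. \<integral>\<^sup>+ \<theta>. f y \<theta> \<partial>update q nu y \<mu>) \<in> borel_measurable borel"
    by (rule nn_integral_measurable_subprob_algebra2[OF f]) (rule measurable_prob_algebraD, measurable)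
  have "(\<integral>\<^sup>+ \<theta>. \<integral>\<^sup>+ y. f y \<theta> \<partial>offer_dist lam q \<theta> \<partial>\<mu>) = (\<integral>\<^sup>+ \<theta>. \<integral>\<^sup>+ y. ennreal (q y \<theta>) * f y \<theta> \<partial>lam \<partial>\<mu>)"
    by (intro nn_integral_cong nn_integral_offer) (auto simp: sets_eq_imp_space_eq[OF s])
  also have "\<dots> = (\<integral>\<^sup>+ y. \<integral>\<^sup>+ \<theta>. ennreal (q y \<theta>) * f y \<theta> \<partial>\<mu> \<partial>lam)"
    by (rule Fubini') measurable
  also have "\<dots> = (\<integral>\<^sup>+ y. evidence y \<mu> * (\<integral>\<^sup>+ \<theta>. f y \<theta> \<partial>update q nu y \<mu>) \<partial>lam)"
  proof (rule nn_integral_cong_AE, use fin in eventually_elim)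
    fix y assume y: "evidence y \<mu> \<noteq> \<infinity>"
    show "(\<integral>\<^sup>+ \<theta>. ennreal (q y \<theta>) * f y \<theta> \<partial>\<mu>) = evidence y \<mu> * (\<integral>\<^sup>+ \<theta>. f y \<theta> \<partial>update q nu y \<mu>)"
    proof (cases "evidence y \<mu> = 0")
      case True
      then have "AE \<theta> in \<mu>. ennreal (q y \<theta>) = 0"
        unfolding evidence_def by (subst (asm) nn_integral_0_iff_AE) measurable
      then have "(\<integral>\<^sup>+ \<theta>. ennreal (q y \<theta>) * f y \<theta> \<partial>\<mu>) = (\<integral>\<^sup>+ \<theta>. 0 \<partial>\<mu>)"
        by (intro nn_integral_cong_AE) auto
      then show ?thesis using True by simp
    next
      case False
      then have "(\<integral>\<^sup>+ \<theta>. f y \<theta> \<partial>update q nu y \<mu>) = (\<integral>\<^sup>+ \<theta>. ennreal (q y \<theta>) * f y \<theta> \<partial>\<mu>) / evidence y \<mu>"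
        using y by (intro nn_integral_update \<mu>) (auto simp: zero_less_iff_neq_zero top.not_eq_extremum)
      then show ?thesis
        using y False by (simp add: mult.commute[of "evidence y \<mu>"] ennreal_divide_times top.not_eq_extremum)
    qed
  qed
  also have "\<dots> = (\<integral>\<^sup>+ y. \<integral>\<^sup>+ \<theta>. f y \<theta> \<partial>update q nu y \<mu> \<partial>mix_dist lam q \<mu>)"
    by (rule nn_integral_mix[OF \<mu>, symmetric]) measurable
  finally show ?thesis .
qed

text \<open>
  Bayes' rule as an exchange of the order of sampling: parameter first, then offer, against
  offer first, then parameter from the posterior.
\<close>

lemma bayes_bind:
  assumes \<mu>: "\<mu> \<in> space (prob_algebra T)"
    and K[measurable]: "(\<lambda>(y, \<theta>). K y \<theta>) \<in> borel \<Otimes>\<^sub>M T \<rightarrow>\<^sub>M prob_algebra R"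
  shows "\<mu> \<bind> (\<lambda>\<theta>. offer_dist lam q \<theta> \<bind> (\<lambda>y. K y \<theta>)) =
    mix_dist lam q \<mu> \<bind> (\<lambda>y. update q nu y \<mu> \<bind> K y)"
proof -
  have s[measurable_cong]: "sets \<mu> = sets T" and "prob_space \<mu>"
    using \<mu> by (auto simp: space_prob_algebra)
  interpret \<mu>: prob_space \<mu> by fact
  note [measurable] = \<mu>
  note mix = mix_dist_prob[OF \<mu>]
  note [measurable_cong] = mix(2)
  have Ky: "(\<lambda>y. K y \<theta>) \<in> borel \<rightarrow>\<^sub>M prob_algebra R" if "\<theta> \<in> space T" for \<theta>
    using measurable_compose[OF _ K, of "\<lambda>y. (y, \<theta>)"] that by simp
  have Kt: "K y \<in> T \<rightarrow>\<^sub>M prob_algebra R" for y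
    using measurable_compose[OF _ K, of "\<lambda>\<theta>. (y, \<theta>)"] by simp
  have A[measurable]: "(\<lambda>\<theta>. offer_dist lam q \<theta> \<bind> (\<lambda>y. K y \<theta>)) \<in> T \<rightarrow>\<^sub>M prob_algebra R"
    by measurable
  have B[measurable]: "(\<lambda>y. update q nu y \<mu> \<bind> K y) \<in> borel \<rightarrow>\<^sub>M prob_algebra R"
    by measurable
  have A': "(\<lambda>\<theta>. offer_dist lam q \<theta> \<bind> (\<lambda>y. K y \<theta>)) \<in> \<mu> \<rightarrow>\<^sub>M subprob_algebra R"
    by (rule measurable_prob_algebraD) measurable
  have B': "(\<lambda>y. update q nu y \<mu> \<bind> K y) \<in> mix_dist lam q \<mu> \<rightarrow>\<^sub>M subprob_algebra R"
    by (rule measurable_prob_algebraD) measurable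
  show ?thesis
  proof (rule measure_eqI)
    show "sets (\<mu> \<bind> (\<lambda>\<theta>. offer_dist lam q \<theta> \<bind> (\<lambda>y. K y \<theta>))) =
      sets (mix_dist lam q \<mu> \<bind> (\<lambda>y. update q nu y \<mu> \<bind> K y))"
      using mix \<mu>.not_empty by (simp add: sets_bind_measurable[OF A'] sets_bind_measurable[OF B'])
    fix X assume "X \<in> sets (\<mu> \<bind> (\<lambda>\<theta>. offer_dist lam q \<theta> \<bind> (\<lambda>y. K y \<theta>)))"
    then have X[measurable]: "X \<in> sets R"
      using \<mu>.not_empty by (simp add: sets_bind_measurable[OF A'])
    have [measurable]: "(\<lambda>(y, \<theta>). emeasure (K y \<theta>) X) \<in> borel_measurable (borel \<Otimes>\<^sub>M T)"
      using measurable_compose[OF measurable_prob_algebraD[OF K] measurable_emeasure_subprob_algebra[OF X]]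
      by (simp add: split_beta')
    have "emeasure (\<mu> \<bind> (\<lambda>\<theta>. offer_dist lam q \<theta> \<bind> (\<lambda>y. K y \<theta>))) X =
      (\<integral>\<^sup>+ \<theta>. emeasure (offer_dist lam q \<theta> \<bind> (\<lambda>y. K y \<theta>)) X \<partial>\<mu>)"
      by (rule emeasure_bind[OF \<mu>.not_empty A' X])
    also have "\<dots> = (\<integral>\<^sup>+ \<theta>. \<integral>\<^sup>+ y. emeasure (K y \<theta>) X \<partial>offer_dist lam q \<theta> \<partial>\<mu>)"
    proof (rule nn_integral_cong)
      fix \<theta> assume "\<theta> \<in> space \<mu>"
      then have \<theta>: "\<theta> \<in> space T" by (simp add: sets_eq_imp_space_eq[OF s])
      show "emeasure (offer_dist lam q \<theta> \<bind> (\<lambda>y. K y \<theta>)) X = (\<integral>\<^sup>+ y. emeasure (K y \<theta>) X \<partial>offer_dist lam q \<theta>)"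
        using prob_space.not_empty[OF prob_offer[OF \<theta>]] measurable_prob_algebraD[OF Ky[OF \<theta>]]
        by (intro emeasure_bind[OF _ _ X]) (auto simp: offer_dist_def sets_lam cong: measurable_cong_sets)
    qed
    also have "\<dots> = (\<integral>\<^sup>+ y. \<integral>\<^sup>+ \<theta>. emeasure (K y \<theta>) X \<partial>update q nu y \<mu> \<partial>mix_dist lam q \<mu>)"
      by (rule bayes_formula[OF \<mu>]) measurable
    also have "\<dots> = (\<integral>\<^sup>+ y. emeasure (update q nu y \<mu> \<bind> K y) X \<partial>mix_dist lam q \<mu>)"
    proof (rule nn_integral_cong)
      fix y
      have "sets (update q nu y \<mu>) = sets T" "prob_space (update q nu y \<mu>)"
        using update_prob[OF \<mu>] by (auto simp: space_prob_algebra)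
      then show "(\<integral>\<^sup>+ \<theta>. emeasure (K y \<theta>) X \<partial>update q nu y \<mu>) = emeasure (update q nu y \<mu> \<bind> K y) X"
        using prob_space.not_empty[of "update q nu y \<mu>"] measurable_prob_algebraD[OF Kt]
        by (intro emeasure_bind[OF _ _ X, symmetric]) (auto cong: measurable_cong_sets)
    qed
    also have "\<dots> = emeasure (mix_dist lam q \<mu> \<bind> (\<lambda>y. update q nu y \<mu> \<bind> K y)) X"
      using mix by (intro emeasure_bind[OF _ B' X, symmetric]) auto
    finally show "emeasure (\<mu> \<bind> (\<lambda>\<theta>. offer_dist lam q \<theta> \<bind> (\<lambda>y. K y \<theta>))) X =
      emeasure (mix_dist lam q \<mu> \<bind> (\<lambda>y. update q nu y \<mu> \<bind> K y)) X" .
  qed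
qed

end

section \<open>Laws of offer paths\<close>

abbreviation paths :: "(nat \<Rightarrow> real) measure" where
  "paths \<equiv> \<Pi>\<^sub>M n\<in>UNIV. borel"

text \<open>
  The law of the offer path when the first offer is \<open>x\<close> and the parameter has
  distribution \<open>\<mu>\<close>. Payoffs do not depend on the parameter itself, so they can be integrated
  against this mixture.
\<close>

definition path_mix ::
  "real measure \<Rightarrow> (real \<Rightarrow> 't \<Rightarrow> real) \<Rightarrow> real \<Rightarrow> 't measure \<Rightarrow> (nat \<Rightarrow> real) measure" where
  "path_mix lam q x \<mu> = \<mu> \<bind> path_measure lam q x"

text \<open>
  A sequence of independent variables is its first component followed by the others. The factors
  may differ, since the initial offer is deterministic and the later ones are not. Both sides give
  a finite-dimensional cylinder the same product, with the factor of index 0 split off.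
\<close>

lemma PiM_eq_bind_case_nat:
  fixes M :: "nat \<Rightarrow> 'a measure"
  assumes M: "\<And>i. prob_space (M i)"
  shows "(\<Pi>\<^sub>M i\<in>UNIV. M i) =
    M 0 \<bind> (\<lambda>s. distr (\<Pi>\<^sub>M i\<in>UNIV. M (Suc i)) (\<Pi>\<^sub>M i\<in>UNIV. M i) (case_nat s))"
proof -
  interpret product_prob_space M UNIV
    by (intro product_prob_spaceI M)
  interpret tail: product_prob_space "\<lambda>i. M (Suc i)" UNIV
    by (intro product_prob_spaceI M)
  let ?P = "\<Pi>\<^sub>M i\<in>UNIV. M i" and ?S = "\<Pi>\<^sub>M i\<in>UNIV. M (Suc i)"
  let ?K = "\<lambda>s. distr ?S ?P (case_nat s)"
  have cons: "case_nat s \<in> ?S \<rightarrow>\<^sub>M ?P" if "s \<in> space (M 0)" for s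
  proof (rule measurable_PiM_single')
    show "(\<lambda>\<omega>. case_nat s \<omega> i) \<in> ?S \<rightarrow>\<^sub>M M i" for i
      using that by (cases i) auto
  qed (use that in \<open>auto simp: space_PiM PiE_iff split: nat.split\<close>)
  have "(\<lambda>(s, \<omega>). case_nat s \<omega>) \<in> M 0 \<Otimes>\<^sub>M ?S \<rightarrow>\<^sub>M ?P"
  proof (rule measurable_PiM_single')
    show "(\<lambda>z. (case z of (s, \<omega>) \<Rightarrow> case_nat s \<omega>) i) \<in> M 0 \<Otimes>\<^sub>M ?S \<rightarrow>\<^sub>M M i" for i
      by (cases i) (auto simp: split_beta')
  qed (auto simp: space_pair_measure space_PiM PiE_iff split: nat.split)
  then have K: "?K \<in> M 0 \<rightarrow>\<^sub>M subprob_algebra ?P"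
    by (rule measurable_distr2)
      (simp add: space_subprob_algebra prob_space_imp_subprob_space tail.P.prob_space_axioms)
  show ?thesis
  proof (rule PiM_eq[symmetric])
    show "sets (M 0 \<bind> ?K) = sets ?P"
      by (rule sets_bind_measurable[OF K M.not_empty])
    fix J :: "nat set" and F
    assume J: "finite J" and F: "\<And>j. j \<in> J \<Longrightarrow> F j \<in> sets (M j)"
    define X where "X = prod_emb UNIV M J (Pi\<^sub>E J F)"
    define E where "E = (if 0 \<in> J then F 0 else space (M 0))"
    define Y where "Y = prod_emb UNIV (\<lambda>i. M (Suc i)) (Suc -` J) (\<Pi>\<^sub>E j\<in>Suc -` J. F (Suc j))"
    have X: "X \<in> sets ?P"
      unfolding X_def by (rule sets_PiM_I) (use J F in auto)
    have E: "E \<in> sets (M 0)" using F by (auto simp: E_def)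
    have "case_nat s -` X \<inter> space ?S = (if s \<in> E then Y else {})" if "s \<in> space (M 0)" for s
      using that F[THEN sets.sets_into_space]
      by (auto simp: X_def E_def Y_def prod_emb_def PiE_iff space_PiM all_conj_distrib subset_eq
          split: nat.split nat.split_asm)
    then have "emeasure (?K s) X = emeasure ?S Y * indicator E s" if "s \<in> space (M 0)" for s
      using that by (simp add: emeasure_distr[OF cons X])
    then have "emeasure (M 0 \<bind> ?K) X = (\<integral>\<^sup>+ s. emeasure ?S Y * indicator E s \<partial>M 0)"
      by (simp add: emeasure_bind[OF M.not_empty K X] cong: nn_integral_cong)
    also have "\<dots> = emeasure ?S Y * emeasure (M 0) E"
      by (rule nn_integral_cmult_indicator[OF E])
    also have "emeasure ?S Y = (\<Prod>j\<in>Suc -` J. emeasure (M (Suc j)) (F (Suc j)))"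
      unfolding Y_def by (rule tail.emeasure_PiM_emb) (use J F in \<open>simp_all add: finite_vimageI\<close>)
    also have "\<dots> = (\<Prod>j\<in>J - {0}. emeasure (M j) (F j))"
      by (rule prod.reindex_bij_witness[of _ "\<lambda>j. j - 1" Suc]) auto
    also have "\<dots> * emeasure (M 0) E = (\<Prod>j\<in>J. emeasure (M j) (F j))"
      using J by (auto simp: E_def M.emeasure_space_1 prod.remove[of J 0] mult.commute)
    finally show "emeasure (M 0 \<bind> ?K) (prod_emb UNIV M J (Pi\<^sub>E J F)) = (\<Prod>j\<in>J. emeasure (M j) (F j))"
      unfolding X_def .
  qed
qed

context bayes_model
begin

lemma case_nat_paths[measurable (raw)]:
  "f \<in> M \<rightarrow>\<^sub>M borel \<Longrightarrow> g \<in> M \<rightarrow>\<^sub>M paths \<Longrightarrow> (\<lambda>x. case_nat (f x) (g x)) \<in> M \<rightarrow>\<^sub>M paths"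
  by (rule measurable_PiM_single') (auto simp: space_PiM split: nat.split)

lemma path_component_prob:
  assumes "\<theta> \<in> space T"
  shows "prob_space (if n = (0::nat) then return borel x else offer_dist lam q \<theta>)"
  using prob_offer[OF assms] by (auto intro: prob_space_return)

lemma path_prob:
  assumes "\<theta> \<in> space T"
  shows "prob_space (path_measure lam q x \<theta>)" "sets (path_measure lam q x \<theta>) = sets paths"
proof -
  show "prob_space (path_measure lam q x \<theta>)"
    unfolding path_measure_def by (intro prob_space_PiM path_component_prob assms)
  show "sets (path_measure lam q x \<theta>) = sets paths"
    unfolding path_measure_def by (intro sets_PiM_cong) (auto simp: offer_dist_def sets_lam)
qed

lemma path_measurable:
  "(\<lambda>(x, \<theta>). path_measure lam q x \<theta>) \<in> borel \<Otimes>\<^sub>M T \<rightarrow>\<^sub>M prob_algebra paths"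
proof (rule measurable_prob_algebra_generated[OF sets_PiM Int_stable_prod_algebra prod_algebra_sets_into_space])
  let ?M = "borel \<Otimes>\<^sub>M T :: (real \<times> 't) measure"
  fix z assume "z \<in> space ?M"
  then show "prob_space (case z of (x, \<theta>) \<Rightarrow> path_measure lam q x \<theta>)"
    "sets (case z of (x, \<theta>) \<Rightarrow> path_measure lam q x \<theta>) = sets paths"
    by (auto simp: space_pair_measure path_prob)
next
  let ?M = "borel \<Otimes>\<^sub>M T :: (real \<times> 't) measure"
  fix A :: "(nat \<Rightarrow> real) set" assume "A \<in> prod_algebra UNIV (\<lambda>_. borel)"
  then obtain J :: "nat set" and E where J: "A = prod_emb UNIV (\<lambda>_. borel) J (Pi\<^sub>E J E)" "finite J"
    "\<And>j. j \<in> J \<Longrightarrow> E j \<in> sets borel"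
    by (elim prod_algebraE) auto
  have comp: "(\<lambda>z. emeasure (if j = 0 then return borel (fst z) else offer_dist lam q (snd z)) (E j))
      \<in> borel_measurable ?M" if "j \<in> J" for j
  proof -
    have [measurable]: "E j \<in> sets borel" by (rule J(3)[OF that])
    have "(\<lambda>z. offer_dist lam q (snd z)) \<in> ?M \<rightarrow>\<^sub>M prob_algebra borel" by measurable
    note [measurable] = measurable_prob_algebraD[OF this]
    show ?thesis
    proof (cases "j = 0")
      case True
      have "(\<lambda>z. indicator (E j) (fst z) :: ennreal) \<in> borel_measurable ?M"
        by measurable
      then show ?thesis using True J(3)[OF that] by simp
    next
      case False
      then show ?thesis by simp measurable
    qed
  qed
  have eq: "emeasure (path_measure lam q (fst z) (snd z)) A =
      (\<Prod>j\<in>J. emeasure (if j = 0 then return borel (fst z) else offer_dist lam q (snd z)) (E j))"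
    if "z \<in> space ?M" for z
  proof -
    have z: "snd z \<in> space T" using that by (auto simp: space_pair_measure)
    interpret product_prob_space "\<lambda>n. if n = 0 then return borel (fst z) else offer_dist lam q (snd z)" "UNIV :: nat set"
      by (intro product_prob_spaceI path_component_prob z)
    have "A = prod_emb UNIV (\<lambda>n. if n = 0 then return borel (fst z) else offer_dist lam q (snd z)) J (Pi\<^sub>E J E)"
      by (auto simp: J(1) prod_emb_def offer_dist_def)
    then show ?thesis
      unfolding path_measure_def
      by (simp only:) (rule emeasure_PiM_emb, use J in \<open>auto simp: offer_dist_def sets_lam\<close>)
  qed
  show "(\<lambda>z. emeasure (case z of (x, \<theta>) \<Rightarrow> path_measure lam q x \<theta>) A) \<in> borel_measurable ?M"
    unfolding split_beta by (subst measurable_cong[OF eq]) (assumption, rule borel_measurable_prod_ennreal, erule comp)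
qed

lemma measurable_path[measurable (raw)]:
  "f \<in> M \<rightarrow>\<^sub>M borel \<Longrightarrow> g \<in> M \<rightarrow>\<^sub>M T \<Longrightarrow> (\<lambda>z. path_measure lam q (f z) (g z)) \<in> M \<rightarrow>\<^sub>M prob_algebra paths"
  using measurable_compose[OF measurable_Pair path_measurable, of f M g] by simp

text \<open>
  Given the parameter, both the path from \<open>x\<close> and the path from \<open>y\<close> are the same i.i.d. sequence
  with the initial offer put in front; splitting off the first term of that sequence produces
  the next offer \<open>y\<close>.
\<close>

lemma path_step:
  assumes \<theta>: "\<theta> \<in> space T"
  shows "path_measure lam q x \<theta> =
    offer_dist lam q \<theta> \<bind> (\<lambda>y. distr (path_measure lam q y \<theta>) paths (case_nat x))"
proof -
  let ?Q = "offer_dist lam q \<theta>"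
  define S where "S = (\<Pi>\<^sub>M n\<in>(UNIV::nat set). ?Q)"
  note Q = prob_offer[OF \<theta>]
  have setsQ: "sets ?Q = sets borel" by (simp add: offer_dist_def sets_lam)
  have S[measurable]: "S \<in> space (prob_algebra paths)"
    unfolding S_def using prob_space_PiM[where I="UNIV :: nat set" and M="\<lambda>_. ?Q"] Q setsQ
    by (auto simp: space_prob_algebra intro!: sets_PiM_cong)
  then have setsS[measurable_cong]: "sets S = sets paths" by (simp add: space_prob_algebra)
  have K: "(\<lambda>y. distr S paths (case_nat y)) \<in> borel \<rightarrow>\<^sub>M prob_algebra paths"
    using S by (intro measurable_distr_prob_space2[where M=paths]) auto
  have path: "path_measure lam q y \<theta> = distr S paths (case_nat y)" for y
  proof -
    have "path_measure lam q y \<theta> =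
      return borel y \<bind> (\<lambda>s. distr S (path_measure lam q y \<theta>) (case_nat s))"
      unfolding path_measure_def S_def
      by (subst PiM_eq_bind_case_nat[OF path_component_prob[OF \<theta>]]) simp
    also have "(\<lambda>s. distr S (path_measure lam q y \<theta>) (case_nat s)) = (\<lambda>s. distr S paths (case_nat s))"
      by (intro ext distr_cong refl path_prob \<theta>)
    also have "return borel y \<bind> \<dots> = distr S paths (case_nat y)"
      by (rule bind_return[OF measurable_prob_algebraD[OF K]]) simp
    finally show ?thesis .
  qed
  have "S = ?Q \<bind> (\<lambda>s. distr S S (case_nat s))"
    unfolding S_def by (rule PiM_eq_bind_case_nat[OF Q])
  also have "(\<lambda>s. distr S S (case_nat s)) = (\<lambda>s. path_measure lam q s \<theta>)"
    unfolding path by (intro ext distr_cong refl setsS)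
  finally have "path_measure lam q x \<theta> = distr (?Q \<bind> (\<lambda>s. path_measure lam q s \<theta>)) paths (case_nat x)"
    by (simp add: path[of x])
  also have "\<dots> = ?Q \<bind> (\<lambda>y. distr (path_measure lam q y \<theta>) paths (case_nat x))"
  proof (rule distr_bind[where K=paths])
    have "(\<lambda>s. path_measure lam q s \<theta>) \<in> borel \<rightarrow>\<^sub>M prob_algebra paths"
      using \<theta> by measurable
    then show "(\<lambda>s. path_measure lam q s \<theta>) \<in> ?Q \<rightarrow>\<^sub>M subprob_algebra paths"
      using setsQ by (auto dest: measurable_prob_algebraD cong: measurable_cong_sets)
  qed (use prob_space.not_empty[OF Q] in auto)
  finally show ?thesis .
qed

lemma path_mix_measurable[measurable (raw)]:
  assumes [measurable]: "f \<in> M \<rightarrow>\<^sub>M borel" "L \<in> M \<rightarrow>\<^sub>M prob_algebra T"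
  shows "(\<lambda>z. path_mix lam q (f z) (L z)) \<in> M \<rightarrow>\<^sub>M prob_algebra paths"
  unfolding path_mix_def by measurable

lemma path_mix_prob:
  assumes "\<mu> \<in> space (prob_algebra T)"
  shows "path_mix lam q x \<mu> \<in> space (prob_algebra paths)"
  using measurable_space[OF path_mix_measurable[of "\<lambda>_. x" "prob_algebra T" "\<lambda>\<mu>. \<mu>"] assms] by simp

text \<open>
  The law of the offers from time 1 on, described through the first of them and the belief
  that it induces.
\<close>

definition future_paths :: "'t measure \<Rightarrow> (nat \<Rightarrow> real) measure" where
  "future_paths \<mu> = mix_dist lam q \<mu> \<bind> (\<lambda>y. path_mix lam q y (update q nu y \<mu>))"

lemma future_kernel:
  assumes \<mu>: "\<mu> \<in> space (prob_algebra T)"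
  shows "(\<lambda>y. path_mix lam q y (update q nu y \<mu>)) \<in> mix_dist lam q \<mu> \<rightarrow>\<^sub>M subprob_algebra paths"
proof -
  note [measurable_cong] = mix_dist_prob(2)[OF \<mu>]
  note [measurable] = \<mu>
  show ?thesis by (rule measurable_prob_algebraD) measurable
qed

lemma future_paths_prob:
  assumes \<mu>: "\<mu> \<in> space (prob_algebra T)"
  shows "future_paths \<mu> \<in> space (prob_algebra paths)"
proof -
  have "future_paths \<in> prob_algebra T \<rightarrow>\<^sub>M prob_algebra paths"
    unfolding future_paths_def by measurable
  from measurable_space[OF this \<mu>] show ?thesis .
qed

lemma nn_integral_future_paths:
  assumes "\<mu> \<in> space (prob_algebra T)" "f \<in> borel_measurable paths"
  shows "(\<integral>\<^sup>+ \<omega>. f \<omega> \<partial>future_paths \<mu>) =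
    (\<integral>\<^sup>+ y. \<integral>\<^sup>+ \<omega>. f \<omega> \<partial>path_mix lam q y (update q nu y \<mu>) \<partial>mix_dist lam q \<mu>)"
  unfolding future_paths_def using assms by (intro nn_integral_bind[OF _ future_kernel])

lemma case_nat_future_paths:
  assumes "\<mu> \<in> space (prob_algebra T)"
  shows "case_nat x \<in> future_paths \<mu> \<rightarrow>\<^sub>M paths"
proof -
  have [measurable_cong]: "sets (future_paths \<mu>) = sets paths"
    using future_paths_prob[OF assms] by (simp add: space_prob_algebra)
  show ?thesis by measurable
qed

text \<open>
  The Markov property of offer and belief: the parameter-wise decomposition \<open>path_step\<close>
  followed by the exchange \<open>bayes_bind\<close>.
\<close>

lemma path_mix_step:
  assumes \<mu>: "\<mu> \<in> space (prob_algebra T)"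
  shows "path_mix lam q x \<mu> =
    distr (future_paths \<mu>) paths (case_nat x)"
proof -
  have s[measurable_cong]: "sets \<mu> = sets T" using \<mu> by (simp add: space_prob_algebra)
  note [measurable_cong] = mix_dist_prob(2)[OF \<mu>]
  have "path_mix lam q x \<mu> =
    \<mu> \<bind> (\<lambda>\<theta>. offer_dist lam q \<theta> \<bind> (\<lambda>y. distr (path_measure lam q y \<theta>) paths (case_nat x)))"
    unfolding path_mix_def
    by (intro bind_cong refl path_step) (simp flip: sets_eq_imp_space_eq[OF s])
  also have "\<dots> = mix_dist lam q \<mu> \<bind>
      (\<lambda>y. update q nu y \<mu> \<bind> (\<lambda>\<theta>. distr (path_measure lam q y \<theta>) paths (case_nat x)))"
    by (rule bayes_bind[OF \<mu>]) measurable
  also have "\<dots> = mix_dist lam q \<mu> \<bind> (\<lambda>y. distr (path_mix lam q y (update q nu y \<mu>)) paths (case_nat x))"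
  proof (intro bind_cong refl)
    fix y
    have u: "sets (update q nu y \<mu>) = sets T" "space (update q nu y \<mu>) \<noteq> {}"
      using update_prob[OF \<mu>, of y] by (auto simp: space_prob_algebra dest: prob_space.not_empty)
    note [measurable_cong] = u(1)
    show "update q nu y \<mu> \<bind> (\<lambda>\<theta>. distr (path_measure lam q y \<theta>) paths (case_nat x)) =
      distr (path_mix lam q y (update q nu y \<mu>)) paths (case_nat x)"
      unfolding path_mix_def
      by (rule distr_bind[symmetric, OF _ u(2)]) (rule measurable_prob_algebraD, measurable)
  qed
  also have "\<dots> = distr (future_paths \<mu>) paths (case_nat x)"
    unfolding future_paths_def
    by (rule distr_bind[symmetric, OF future_kernel[OF \<mu>]]) (simp_all add: mix_dist_prob[OF \<mu>])
  finally show ?thesis .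
qed

lemma nn_integral_path_mix:
  assumes \<mu>: "\<mu> \<in> space (prob_algebra T)" and f: "f \<in> borel_measurable paths"
  shows "(\<integral>\<^sup>+ \<omega>. f \<omega> \<partial>path_mix lam q x \<mu>) = (\<integral>\<^sup>+ \<omega>. f (case_nat x \<omega>) \<partial>future_paths \<mu>)"
  using case_nat_future_paths[OF \<mu>] f by (simp add: path_mix_step[OF \<mu>] nn_integral_distr)

end

section \<open>Stopping times on path space\<close>

lemma space_offer_filtration[simp]: "space (offer_filtration n) = UNIV"
  by (simp add: offer_filtration_def)

lemma sets_offer_filtration:
  "sets (offer_filtration n) = sigma_sets UNIV {{\<omega>. \<omega> i \<in> B} |i B. i \<le> n \<and> B \<in> sets borel}"
  by (simp add: offer_filtration_def)

lemma measurable_coordinate_filtration: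
  "i \<le> n \<Longrightarrow> (\<lambda>\<omega>. \<omega> i) \<in> offer_filtration n \<rightarrow>\<^sub>M borel"
  by (rule measurableI) (auto simp: sets_offer_filtration vimage_def intro!: sigma_sets.Basic)

text \<open>
  Events known at time \<open>n\<close> cannot distinguish paths that agree up to time \<open>n\<close>.
\<close>

lemma offer_filtration_determined:
  assumes "A \<in> sets (offer_filtration n)" and eq: "\<And>i. i \<le> n \<Longrightarrow> \<omega> i = \<omega>' i"
  shows "\<omega> \<in> A \<longleftrightarrow> \<omega>' \<in> A"
  using assms(1) unfolding sets_offer_filtration
  by (induction rule: sigma_sets.induct) (auto simp: eq)

lemma measurable_offer_filtration:
  fixes f :: "'a \<Rightarrow> nat \<Rightarrow> real"
  assumes "\<And>i. i \<le> n \<Longrightarrow> (\<lambda>z. f z i) \<in> M \<rightarrow>\<^sub>M borel"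
  shows "f \<in> M \<rightarrow>\<^sub>M offer_filtration n"
  unfolding offer_filtration_def
proof (rule measurable_measure_of)
  fix A :: "(nat \<Rightarrow> real) set" assume "A \<in> {{\<omega>. \<omega> i \<in> B} |i B. i \<le> n \<and> B \<in> sets borel}"
  then obtain i B where A: "A = {\<omega>. \<omega> i \<in> B}" "i \<le> n" "B \<in> sets borel" by auto
  show "f -` A \<inter> space M \<in> sets M"
    using measurable_sets[OF assms[OF A(2)] A(3)] by (simp add: A(1) vimage_def)
qed auto

lemma measurable_case_nat_filtration:
  "case_nat x \<in> offer_filtration n \<rightarrow>\<^sub>M offer_filtration (Suc n)"
proof (rule measurable_offer_filtration)
  fix i assume "i \<le> Suc n"
  then show "(\<lambda>\<omega>. case_nat x \<omega> i) \<in> offer_filtration n \<rightarrow>\<^sub>M borel"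
    by (cases i) (auto intro: measurable_coordinate_filtration)
qed

lemma stopping_time_measurable_paths:
  assumes "\<tau> \<in> stopping_times n"
  shows "\<tau> \<in> paths \<rightarrow>\<^sub>M count_space UNIV"
proof (rule measurable_count_space_eq2_countable[THEN iffD2])
  have le: "Measurable.pred paths (\<lambda>\<omega>. \<tau> \<omega> \<le> t)" for t
  proof -
    have "(\<lambda>\<omega>. \<omega>) \<in> paths \<rightarrow>\<^sub>M offer_filtration t"
      by (rule measurable_offer_filtration) measurable
    moreover have "Measurable.pred (offer_filtration t) (\<lambda>\<omega>. \<tau> \<omega> \<le> t)"
      using assms by (auto simp: stopping_times_def stopping_time_def)
    ultimately show ?thesis by (rule measurable_compose)
  qed
  note [measurable] = le
  have "Measurable.pred paths (\<lambda>\<omega>. \<tau> \<omega> = m)" for m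
  proof -
    have "(\<lambda>\<omega>. \<tau> \<omega> = m) = (\<lambda>\<omega>. \<tau> \<omega> \<le> m \<and> (m = 0 \<or> \<not> \<tau> \<omega> \<le> m - 1))"
      by (cases m) auto
    then show ?thesis by simp
  qed
  then show "\<tau> \<in> space paths \<rightarrow> UNIV \<and> (\<forall>m\<in>UNIV. \<tau> -` {m} \<inter> space paths \<in> sets paths)"
    by (auto simp: pred_def vimage_def Int_def conj_commute)
qed

text \<open>
  The decision at time 0 depends on the first offer only.
\<close>

lemma stopping_time_start:
  assumes "\<tau> \<in> stopping_times n"
  shows "(\<forall>\<omega>. \<tau> (case_nat x \<omega>) = 0) \<or> (\<forall>\<omega>. 1 \<le> \<tau> (case_nat x \<omega>))"
proof -
  have "{\<omega>. \<tau> \<omega> \<le> 0} \<in> sets (offer_filtration 0)"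
    using assms stopping_timeD[of offer_filtration \<tau> 0] by (simp add: stopping_times_def pred_def)
  from offer_filtration_determined[OF this, of "case_nat x _" "case_nat x _"] show ?thesis
    by (auto simp: Suc_le_eq)
qed

text \<open>
  Once the first offer is fixed, what is known of the longer path at time \<open>t + 1\<close> is what is
  known of the shorter path at time \<open>t\<close>.
\<close>

lemma stopping_time_section:
  assumes \<tau>: "\<tau> \<in> stopping_times (Suc n)" and pos: "\<And>\<omega>. 1 \<le> \<tau> (case_nat x \<omega>)"
  shows "(\<lambda>\<omega>. \<tau> (case_nat x \<omega>) - 1) \<in> stopping_times n"
  unfolding stopping_times_def
proof (intro CollectI conjI allI stopping_timeI)
  fix t
  have "Measurable.pred (offer_filtration (Suc t)) (\<lambda>\<omega>. \<tau> \<omega> \<le> Suc t)"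
    using \<tau> by (auto simp: stopping_times_def stopping_time_def)
  from measurable_compose[OF measurable_case_nat_filtration this]
  show "Measurable.pred (offer_filtration t) (\<lambda>\<omega>. \<tau> (case_nat x \<omega>) - 1 \<le> t)"
    by (simp add: le_diff_conv)
next
  fix \<omega> show "\<tau> (case_nat x \<omega>) - 1 \<le> n"
    using \<tau> by (auto simp: stopping_times_def le_diff_conv)
qed

section \<open>Value functions\<close>

text \<open>
  Adds the economic part. \<open>K\<close> is a common bound of the mean positive parts of the offers.
\<close>

locale house_selling = bayes_model T lam q nu
  for T :: "'t measure" and lam :: "real measure" and q :: "real \<Rightarrow> 't \<Rightarrow> real"
    and nu :: "'t measure" +
  fixes c :: real and U :: "real \<Rightarrow> real" and K :: ennreal
  assumes c_pos: "0 < c" and U_strict_mono: "strict_mono U" and U_concave: "concave_on UNIV U"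
    and K_finite: "K < \<infinity>"
    and offer_mean: "\<And>\<theta>. \<theta> \<in> space T \<Longrightarrow> (\<integral>\<^sup>+ y. ennreal (max y 0) \<partial>offer_dist lam q \<theta>) \<le> K"
begin

lemma U_continuous: "continuous_on UNIV U"
  using convex_on_continuous[of UNIV "\<lambda>x. - U x"] U_concave continuous_on_minus[of UNIV "\<lambda>x. - U x"]
  by (simp add: concave_on_def)

lemma U_measurable[measurable]: "U \<in> borel_measurable borel"
  by (rule borel_measurable_continuous_onI[OF U_continuous])

lemma U_mono: "x \<le> y \<Longrightarrow> U x \<le> U y"
  using U_strict_mono by (simp add: strict_mono_less_eq)

text \<open>
  The increase of \<open>U\<close> over $[0,1]$ bounds, by concavity, its slope beyond 1. The growth bounds
  below all share this constant, so that inductive steps change only the additive term.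
\<close>

definition slope :: ennreal where "slope = ennreal (U 1 - U 0)"

text \<open>
  Beyond 1, a concave function stays below its chord through 0 and 1; before 1, monotonicity
  bounds it by its value at 1.
\<close>

lemma utility_growth: "\<exists>C<\<infinity>. \<forall>x. ennreal (U (x + s)) \<le> C + slope * ennreal (max x 0)"
proof -
  have b: "0 \<le> U 1 - U 0" using U_mono[of 0 1] by simp
  have lin: "U z \<le> \<bar>U 0\<bar> + \<bar>U 1\<bar> + (U 1 - U 0) * max z 0" for z
  proof (cases "z \<le> 1")
    case True
    have "U z \<le> \<bar>U 0\<bar> + \<bar>U 1\<bar>" using U_mono[OF True] by linarith
    moreover have "0 \<le> (U 1 - U 0) * max z 0" using b by simp
    ultimately show ?thesis by linarith
  next
    case False
    \<comment> \<open>the point 1 lies between 0 and \<open>z\<close>, with weight \<open>1 / z\<close> on \<open>z\<close>\<close>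
    have "(1 - 1 / z) * U 0 + (1 / z) * U z \<le> U ((1 - 1 / z) * 0 + (1 / z) * z)"
      using concave_onD[OF U_concave, of "1 / z" 0 z] False by simp
    then have "(1 - 1 / z) * U 0 + (1 / z) * U z \<le> U 1" using False by simp
    then have "z * ((1 - 1 / z) * U 0 + (1 / z) * U z) \<le> z * U 1"
      using False by (intro mult_left_mono) auto
    moreover have "z * ((1 - 1 / z) * U 0 + (1 / z) * U z) = (z - 1) * U 0 + U z"
      using False by (simp add: field_simps)
    ultimately have "U z \<le> U 0 + (U 1 - U 0) * z" by (simp add: algebra_simps)
    then show ?thesis using False by simp
  qed
  define A where "A = \<bar>U 0\<bar> + \<bar>U 1\<bar> + (U 1 - U 0) * \<bar>s\<bar>"
  have A: "0 \<le> A" using b by (simp add: A_def)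
  have "ennreal (U (x + s)) \<le> ennreal A + slope * ennreal (max x 0)" for x
  proof -
    have m: "0 \<le> max x 0" by simp
    have "(U 1 - U 0) * max (x + s) 0 \<le> (U 1 - U 0) * (\<bar>s\<bar> + max x 0)"
      using b by (intro mult_left_mono) auto
    then have "U (x + s) \<le> A + (U 1 - U 0) * max x 0"
      using lin[of "x + s"] by (simp add: A_def distrib_left)
    then have "ennreal (U (x + s)) \<le> ennreal (A + (U 1 - U 0) * max x 0)"
      by (rule ennreal_leI)
    also have "\<dots> = ennreal A + slope * ennreal (max x 0)"
      by (simp only: slope_def ennreal_mult[OF b m] ennreal_plus[OF A mult_nonneg_nonneg[OF b m]])
    finally show ?thesis .
  qed
  then show ?thesis by (intro exI[of _ "ennreal A"]) auto
qed

lemma mix_affine_bound: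
  assumes \<mu>: "\<mu> \<in> space (prob_algebra T)"
  shows "(\<integral>\<^sup>+ y. C + b * ennreal (max y 0) \<partial>mix_dist lam q \<mu>) \<le> C + b * K"
proof -
  have s: "sets \<mu> = sets T" and "prob_space \<mu>"
    using \<mu> by (auto simp: space_prob_algebra)
  interpret \<mu>: prob_space \<mu> by fact
  note mix = mix_dist_prob[OF \<mu>]
  note [measurable_cong] = mix(2)
  have "(\<integral>\<^sup>+ y. ennreal (max y 0) \<partial>mix_dist lam q \<mu>) =
      (\<integral>\<^sup>+ \<theta>. \<integral>\<^sup>+ y. ennreal (max y 0) \<partial>offer_dist lam q \<theta> \<partial>\<mu>)"
    unfolding mix_dist_def
    by (rule nn_integral_bind[where B=borel])
      (use measurable_prob_algebraD[OF offer_measurable] s in \<open>simp_all cong: measurable_cong_sets\<close>)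
  also have "\<dots> \<le> (\<integral>\<^sup>+ \<theta>. K \<partial>\<mu>)"
    by (intro nn_integral_mono offer_mean) (simp flip: sets_eq_imp_space_eq[OF s])
  also have "\<dots> = K" by (simp add: \<mu>.emeasure_space_1)
  finally have "(\<integral>\<^sup>+ y. ennreal (max y 0) \<partial>mix_dist lam q \<mu>) \<le> K" .
  then have "b * (\<integral>\<^sup>+ y. ennreal (max y 0) \<partial>mix_dist lam q \<mu>) \<le> b * K"
    by (rule mult_left_mono) simp
  then show ?thesis
    using prob_space.emeasure_space_1[OF mix(1)] by (simp add: nn_integral_add nn_integral_cmult)
qed

abbreviation V where "V \<equiv> val lam q nu c U"

text \<open>
  The index is off by one against \<open>cont_val\<close>: \<open>cont n\<close> is $c_{n+1}$, the value of waiting for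
  an offer after which \<open>n\<close> more may follow.
\<close>

abbreviation cont where "cont n \<equiv> next_value lam q nu c (V n)"

lemma val_measurable:
  "(\<lambda>(x, \<mu>). V n x \<mu> s) \<in> borel_measurable (borel \<Otimes>\<^sub>M prob_algebra T)"
proof (induction n arbitrary: s)
  case (Suc n)
  have "(\<lambda>(\<mu>, y). V n y (update q nu y \<mu>) (s - c)) \<in> borel_measurable (prob_algebra T \<Otimes>\<^sub>M borel)"
    using measurable_compose[OF _ Suc.IH, of "\<lambda>(\<mu>, y). (y, update q nu y \<mu>)" "prob_algebra T \<Otimes>\<^sub>M borel" "s - c"]
    by (simp add: split_beta')
  then have [measurable]: "(\<lambda>\<mu>. cont n \<mu> s) \<in> borel_measurable (prob_algebra T)"
    unfolding next_value_def by (rule borel_measurable_ext_integral) measurable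
  show ?case by simp
qed simp_all

lemma V_measurable[measurable (raw)]:
  assumes "f \<in> M \<rightarrow>\<^sub>M borel" "L \<in> M \<rightarrow>\<^sub>M prob_algebra T"
  shows "(\<lambda>z. V n (f z) (L z) s) \<in> borel_measurable M"
  using measurable_compose[OF measurable_Pair val_measurable, of f M L] assms by simp

lemma cont_measurable[measurable (raw)]:
  assumes [measurable]: "L \<in> M \<rightarrow>\<^sub>M prob_algebra T"
  shows "(\<lambda>z. cont n (L z) s) \<in> borel_measurable M"
  unfolding next_value_def
  by (rule borel_measurable_ext_integral[where N=borel]) measurable

text \<open>
  The linear bound is inherited along the recursion because the mean positive part of the next
  offer is at most \<open>K\<close> under every belief.
\<close>

lemma val_growth:
  "\<exists>C<\<infinity>. \<forall>x. \<forall>\<mu>\<in>space (prob_algebra T).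
    e2ennreal (V n x \<mu> s) \<le> C + slope * ennreal (max x 0)"
proof (induction n arbitrary: s)
  case 0
  show ?case using utility_growth[of s] by auto
next
  case (Suc n)
  obtain C where C: "C < \<infinity>" "\<And>x. ennreal (U (x + s)) \<le> C + slope * ennreal (max x 0)"
    using utility_growth[of s] by auto
  obtain D where D: "D < \<infinity>" "\<And>x \<mu>. \<mu> \<in> space (prob_algebra T) \<Longrightarrow>
      e2ennreal (V n x \<mu> (s - c)) \<le> D + slope * ennreal (max x 0)"
    using Suc.IH[of "s - c"] by blast
  have cont_le: "e2ennreal (cont n \<mu> s) \<le> D + slope * K" if \<mu>: "\<mu> \<in> space (prob_algebra T)" for \<mu>
  proof -
    have "e2ennreal (cont n \<mu> s) \<le> (\<integral>\<^sup>+ y. e2ennreal (V n y (update q nu y \<mu>) (s - c)) \<partial>mix_dist lam q \<mu>)"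
      unfolding next_value_def by (rule e2ennreal_ext_integral_le)
    also have "\<dots> \<le> (\<integral>\<^sup>+ y. D + slope * ennreal (max y 0) \<partial>mix_dist lam q \<mu>)"
      by (intro nn_integral_mono D update_prob \<mu>)
    also have "\<dots> \<le> D + slope * K" by (rule mix_affine_bound[OF \<mu>])
    finally show ?thesis .
  qed
  have "e2ennreal (V (Suc n) x \<mu> s) \<le> (C + D + slope * K) + slope * ennreal (max x 0)"
    if \<mu>: "\<mu> \<in> space (prob_algebra T)" for x \<mu>
  proof -
    have "e2ennreal (V (Suc n) x \<mu> s) \<le> e2ennreal (ereal (U (x + s))) + e2ennreal (cont n \<mu> s)"
      by (auto simp: max_def)
    also have "\<dots> \<le> (C + slope * ennreal (max x 0)) + (D + slope * K)"
      using C(2)[of x] cont_le[OF \<mu>] by (intro add_mono) simp_all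
    finally show ?thesis by (simp add: add_ac)
  qed
  moreover have "C + D + slope * K < \<infinity>"
    using C(1) D(1) K_finite by (auto simp: slope_def ennreal_mult_less_top)
  ultimately show ?case by blast
qed

text \<open>
  Every value is the utility of some certain amount, and so is every continuation value unless
  it is \<open>-\<infinity>\<close>. Without this, the reservation levels would not be preimages.
\<close>

lemma val_cont_range:
  "\<mu> \<in> space (prob_algebra T) \<Longrightarrow> V n x \<mu> s \<in> ereal ` range U"
  "\<mu> \<in> space (prob_algebra T) \<Longrightarrow> cont n \<mu> s \<in> insert (-\<infinity>) (ereal ` range U)"
proof -
  have step: "cont n \<mu> s \<in> insert (-\<infinity>) (ereal ` range U)"
    if V: "\<And>\<mu> x s. \<mu> \<in> space (prob_algebra T) \<Longrightarrow> V n x \<mu> s \<in> ereal ` range U"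
      and \<mu>: "\<mu> \<in> space (prob_algebra T)" for n \<mu> s
    unfolding next_value_def
  proof (rule ext_integral_mean_value)
    note [measurable_cong] = mix_dist_prob(2)[OF \<mu>]
    note [measurable] = \<mu>
    show "prob_space (mix_dist lam q \<mu>)" by (rule mix_dist_prob[OF \<mu>])
    show "(\<lambda>y. V n y (update q nu y \<mu>) (s - c)) \<in> borel_measurable (mix_dist lam q \<mu>)"
      by measurable
    show "V n y (update q nu y \<mu>) (s - c) \<in> ereal ` range U" for y
      by (rule V[OF update_prob[OF \<mu>]])
    show "continuous_on UNIV U" by (rule U_continuous)
    obtain D where D: "D < \<infinity>" "\<And>x \<mu>. \<mu> \<in> space (prob_algebra T) \<Longrightarrow>
        e2ennreal (V n x \<mu> (s - c)) \<le> D + slope * ennreal (max x 0)"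
      using val_growth[of n "s - c"] by blast
    have "(\<integral>\<^sup>+ y. e2ennreal (V n y (update q nu y \<mu>) (s - c)) \<partial>mix_dist lam q \<mu>) \<le>
        (\<integral>\<^sup>+ y. D + slope * ennreal (max y 0) \<partial>mix_dist lam q \<mu>)"
      by (intro nn_integral_mono D update_prob \<mu>)
    also have "\<dots> \<le> D + slope * K" by (rule mix_affine_bound[OF \<mu>])
    also have "\<dots> < \<infinity>"
      using D(1) K_finite by (auto simp: slope_def ennreal_mult_less_top)
    finally show "(\<integral>\<^sup>+ y. e2ennreal (V n y (update q nu y \<mu>) (s - c)) \<partial>mix_dist lam q \<mu>) < \<infinity>" .
  qed
  have V: "V n x \<mu> s \<in> ereal ` range U" if "\<mu> \<in> space (prob_algebra T)" for n x \<mu> s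
    using that
  proof (induction n arbitrary: x \<mu> s)
    case (Suc n)
    show ?case using step[OF Suc.IH Suc.prems, of s] by (auto simp: max_def)
  qed simp
  show "\<mu> \<in> space (prob_algebra T) \<Longrightarrow> V n x \<mu> s \<in> ereal ` range U" by (rule V)
  show "\<mu> \<in> space (prob_algebra T) \<Longrightarrow> cont n \<mu> s \<in> insert (-\<infinity>) (ereal ` range U)"
    by (rule step[OF V])
qed

section \<open>Optimal stopping by backward induction\<close>

definition payoff :: "((nat \<Rightarrow> real) \<Rightarrow> nat) \<Rightarrow> real \<Rightarrow> (nat \<Rightarrow> real) \<Rightarrow> ereal" where
  "payoff \<tau> s \<omega> = ereal (U (\<omega> (\<tau> \<omega>) + s - c * real (\<tau> \<omega>)))"

text \<open>
  The expected utility of \<open>\<tau>\<close> from state \<open>(x, \<mu>, s)\<close>, as a single integral against the mixed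
  path law.
\<close>

definition value_of :: "((nat \<Rightarrow> real) \<Rightarrow> nat) \<Rightarrow> real \<Rightarrow> 't measure \<Rightarrow> real \<Rightarrow> ereal" where
  "value_of \<tau> x \<mu> s = ext_integral (path_mix lam q x \<mu>) (payoff \<tau> s)"

lemma payoff_measurable:
  assumes "\<tau> \<in> stopping_times n"
  shows "payoff \<tau> s \<in> borel_measurable paths"
proof -
  have coord: "(\<lambda>\<omega>. \<omega> (\<tau> \<omega>)) \<in> borel_measurable paths"
    by (rule measurable_compose_countable[where f="\<lambda>m. \<lambda>\<omega> :: nat \<Rightarrow> real. \<omega> m"])
      (simp_all add: stopping_time_measurable_paths[OF assms])
  have "(\<lambda>\<omega>. real (\<tau> \<omega>)) \<in> borel_measurable paths"
    by (rule measurable_compose[OF stopping_time_measurable_paths[OF assms]]) simp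
  then have "(\<lambda>\<omega>. \<omega> (\<tau> \<omega>) + s - c * real (\<tau> \<omega>)) \<in> borel_measurable paths"
    using coord by (intro borel_measurable_diff borel_measurable_add borel_measurable_times) auto
  from measurable_compose[OF this U_measurable] show ?thesis
    unfolding payoff_def[abs_def] by (rule borel_measurable_ereal)
qed

text \<open>
  The factor \<open>i\<close> is crude, but it lets the bound follow step by step from the Markov property,
  and integrability of payoffs only asks for a finite bound.
\<close>

lemma nn_integral_coordinate_le:
  assumes "\<mu> \<in> space (prob_algebra T)"
  shows "(\<integral>\<^sup>+ \<omega>. ennreal (max (\<omega> i) 0) \<partial>path_mix lam q x \<mu>) \<le> ennreal (max x 0) + of_nat i * K"
  using assms
proof (induction i arbitrary: x \<mu>)
  case (0 x \<mu>)
  interpret P: prob_space "future_paths \<mu>"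
    using future_paths_prob[OF 0] by (simp add: space_prob_algebra)
  show ?case
    by (subst nn_integral_path_mix[OF 0]) (simp_all add: P.emeasure_space_1)
next
  case (Suc i x \<mu>)
  have "(\<integral>\<^sup>+ \<omega>. ennreal (max (\<omega> (Suc i)) 0) \<partial>path_mix lam q x \<mu>) =
    (\<integral>\<^sup>+ y. \<integral>\<^sup>+ \<omega>. ennreal (max (\<omega> i) 0) \<partial>path_mix lam q y (update q nu y \<mu>) \<partial>mix_dist lam q \<mu>)"
    by (simp add: nn_integral_path_mix[OF Suc.prems] nn_integral_future_paths[OF Suc.prems])
  also have "\<dots> \<le> (\<integral>\<^sup>+ y. of_nat i * K + 1 * ennreal (max y 0) \<partial>mix_dist lam q \<mu>)"
    using Suc.IH[OF update_prob[OF Suc.prems]] by (intro nn_integral_mono) (simp add: add.commute)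
  also have "\<dots> \<le> of_nat i * K + 1 * K" by (rule mix_affine_bound[OF Suc.prems])
  also have "\<dots> = of_nat (Suc i) * K" by (simp add: algebra_simps)
  also have "\<dots> \<le> ennreal (max x 0) + of_nat (Suc i) * K" by (rule add_increasing) simp_all
  finally show ?case .
qed

text \<open>
  A payoff is at most linear in the offer accepted, which is dominated by the sum of the positive
  parts of all offers up to the horizon.
\<close>

lemma payoff_finite:
  assumes \<mu>: "\<mu> \<in> space (prob_algebra T)" and \<tau>: "\<And>\<omega>. \<tau> \<omega> \<le> n"
  shows "(\<integral>\<^sup>+ \<omega>. e2ennreal (payoff \<tau> s \<omega>) \<partial>path_mix lam q x \<mu>) < \<infinity>"
proof -
  obtain C where C: "C < \<infinity>" "\<And>x. ennreal (U (x + s)) \<le> C + slope * ennreal (max x 0)"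
    using utility_growth[of s] by auto
  interpret P: prob_space "path_mix lam q x \<mu>"
    using path_mix_prob[OF \<mu>] by (simp add: space_prob_algebra)
  have [measurable_cong]: "sets (path_mix lam q x \<mu>) = sets paths"
    using path_mix_prob[OF \<mu>] by (simp add: space_prob_algebra)
  have "(\<integral>\<^sup>+ \<omega>. e2ennreal (payoff \<tau> s \<omega>) \<partial>path_mix lam q x \<mu>) \<le>
    (\<integral>\<^sup>+ \<omega>. C + slope * (\<Sum>i\<le>n. ennreal (max (\<omega> i) 0)) \<partial>path_mix lam q x \<mu>)"
  proof (rule nn_integral_mono)
    fix \<omega> :: "nat \<Rightarrow> real"
    have "U (\<omega> (\<tau> \<omega>) + s - c * real (\<tau> \<omega>)) \<le> U (\<omega> (\<tau> \<omega>) + s)"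
      using c_pos by (intro U_mono) simp
    then have "e2ennreal (payoff \<tau> s \<omega>) \<le> ennreal (U (\<omega> (\<tau> \<omega>) + s))"
      by (simp add: payoff_def ennreal_leI)
    also have "\<dots> \<le> C + slope * ennreal (max (\<omega> (\<tau> \<omega>)) 0)" by (rule C)
    also have "\<dots> \<le> C + slope * (\<Sum>i\<le>n. ennreal (max (\<omega> i) 0))"
      using \<tau>[of \<omega>] by (intro add_left_mono mult_left_mono member_le_sum) auto
    finally show "e2ennreal (payoff \<tau> s \<omega>) \<le> C + slope * (\<Sum>i\<le>n. ennreal (max (\<omega> i) 0))" .
  qed
  also have "\<dots> = C + slope * (\<Sum>i\<le>n. \<integral>\<^sup>+ \<omega>. ennreal (max (\<omega> i) 0) \<partial>path_mix lam q x \<mu>)"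
    by (simp add: nn_integral_add nn_integral_cmult nn_integral_sum P.emeasure_space_1)
  also have "\<dots> \<le> C + slope * (\<Sum>i\<le>n. ennreal (max x 0) + of_nat i * K)"
    by (intro add_left_mono mult_left_mono sum_mono nn_integral_coordinate_le \<mu>) simp
  also have "\<dots> < \<infinity>"
    using C(1) K_finite
    by (auto simp: slope_def ennreal_mult_less_top of_nat_less_top)
  finally show ?thesis .
qed

lemma value_of_stop:
  assumes \<mu>: "\<mu> \<in> space (prob_algebra T)" and \<tau>: "\<tau> \<in> stopping_times n"
    and stop: "\<And>\<omega>. \<tau> (case_nat x \<omega>) = 0"
  shows "value_of \<tau> x \<mu> s = ereal (U (x + s))"
proof -
  have "prob_space (future_paths \<mu>)"
    using future_paths_prob[OF \<mu>] by (simp add: space_prob_algebra)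
  then show ?thesis
    by (simp add: value_of_def path_mix_step[OF \<mu>] ext_integral_distr[OF case_nat_future_paths[OF \<mu>] payoff_measurable[OF \<tau>]]
        payoff_def stop ext_integral_const)
qed

text \<open>
  The dynamic programming equation for a fixed stopping time. The cost \<open>c\<close> of waiting moves into
  the third state variable, and the section of \<open>\<tau>\<close> counts time from the next offer.
\<close>

lemma value_of_continue:
  assumes \<mu>: "\<mu> \<in> space (prob_algebra T)" and \<tau>: "\<tau> \<in> stopping_times n"
    and pos: "\<And>\<omega>. 1 \<le> \<tau> (case_nat x \<omega>)"
  shows "value_of \<tau> x \<mu> s = ext_integral (mix_dist lam q \<mu>)
    (\<lambda>y. value_of (\<lambda>\<omega>. \<tau> (case_nat x \<omega>) - 1) y (update q nu y \<mu>) (s - c))"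
proof -
  let ?K = "\<lambda>y. path_mix lam q y (update q nu y \<mu>)"
  have meas[measurable]: "payoff \<tau> s \<in> borel_measurable paths" by (rule payoff_measurable[OF \<tau>])
  have pay: "payoff \<tau> s (case_nat x \<omega>) = payoff (\<lambda>\<omega>. \<tau> (case_nat x \<omega>) - 1) (s - c) \<omega>" for \<omega>
    using pos[of \<omega>] by (cases "\<tau> (case_nat x \<omega>)") (auto simp: payoff_def algebra_simps)
  have "value_of \<tau> x \<mu> s = ext_integral (future_paths \<mu>) (\<lambda>\<omega>. payoff \<tau> s (case_nat x \<omega>))"
    by (simp add: value_of_def path_mix_step[OF \<mu>] ext_integral_distr[OF case_nat_future_paths[OF \<mu>] meas])
  also have "\<dots> = ext_integral (mix_dist lam q \<mu>) (\<lambda>y. ext_integral (?K y) (\<lambda>\<omega>. payoff \<tau> s (case_nat x \<omega>)))"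
    unfolding future_paths_def
  proof (rule ext_integral_bind[OF future_kernel[OF \<mu>]])
    show "(\<integral>\<^sup>+ \<omega>. e2ennreal (payoff \<tau> s (case_nat x \<omega>)) \<partial>(mix_dist lam q \<mu> \<bind> ?K)) < \<infinity>"
      using payoff_finite[OF \<mu>, where \<tau>=\<tau> and n=n and s=s and x=x] \<tau>
      by (simp add: stopping_times_def nn_integral_path_mix[OF \<mu>] future_paths_def)
  qed measurable
  finally show ?thesis
    by (simp add: value_of_def pay[abs_def])
qed

lemma value_of_le_val:
  assumes "\<mu> \<in> space (prob_algebra T)" "\<tau> \<in> stopping_times n"
  shows "value_of \<tau> x \<mu> s \<le> V n x \<mu> s"
  using assms
proof (induction n arbitrary: x \<mu> \<tau> s)
  case 0
  then show ?case
    using value_of_stop[OF 0] by (auto simp: stopping_times_def)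
next
  case (Suc n)
  consider "\<forall>\<omega>. \<tau> (case_nat x \<omega>) = 0" | "\<forall>\<omega>. 1 \<le> \<tau> (case_nat x \<omega>)"
    using stopping_time_start[OF Suc.prems(2)] by blast
  then show ?case
  proof cases
    case 1
    then show ?thesis using value_of_stop[OF Suc.prems] by simp
  next
    case 2
    have "value_of \<tau> x \<mu> s \<le> cont n \<mu> s"
      unfolding value_of_continue[OF Suc.prems 2[rule_format]] next_value_def
      by (intro ext_integral_mono Suc.IH update_prob Suc.prems stopping_time_section 2[rule_format])
    then show ?thesis by (simp add: le_max_iff_disj)
  qed
qed

end

text \<open>
  The filter forgets the initial offer; after one further offer it restarts from the updated
  prior.
\<close>

lemma posterior_case_nat:
  "posterior q nu \<mu> (Suc j) (case_nat x \<omega>) = posterior q nu (update q nu (\<omega> 0) \<mu>) j \<omega>"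
  by (induction j) auto

text \<open>
  The optimal rule, stated through utilities instead of reservation levels. The offset \<open>k\<close>
  counts the costs already paid when the rule starts with belief \<open>\<mu>\<close>; it makes the rule after the
  next offer another instance of the same rule, with \<open>n\<close> lowered and \<open>k\<close> raised by one.
  The disjunct \<open>j = n\<close> is the forced stop at the horizon.
\<close>

definition waiting_rule ::
  "real measure \<Rightarrow> (real \<Rightarrow> 't \<Rightarrow> real) \<Rightarrow> 't measure \<Rightarrow> real \<Rightarrow> (real \<Rightarrow> real) \<Rightarrow>
    nat \<Rightarrow> nat \<Rightarrow> 't measure \<Rightarrow> (nat \<Rightarrow> real) \<Rightarrow> nat" where
  "waiting_rule lam q nu c U n k \<mu> \<omega> =
     (LEAST j. j = n \<or> j < n \<and>
       cont_val lam q nu c U (n - j) (posterior q nu \<mu> j \<omega>) (- (real (k + j) * c))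
         \<le> ereal (U (\<omega> j - real (k + j) * c)))"

lemma waiting_rule_0: "waiting_rule lam q nu c U 0 k \<mu> \<omega> = 0"
  by (simp add: waiting_rule_def)

lemma waiting_rule_Suc:
  "waiting_rule lam q nu c U (Suc n) k \<mu> (case_nat x \<omega>) =
    (if cont_val lam q nu c U (Suc n) \<mu> (- (real k * c)) \<le> ereal (U (x - real k * c)) then 0
     else Suc (waiting_rule lam q nu c U n (Suc k) (update q nu (\<omega> 0) \<mu>) \<omega>))"
  (is "_ = (if ?stop then _ else _)")
proof (cases ?stop)
  case True
  then show ?thesis
    unfolding waiting_rule_def by (auto intro!: Least_equality)
next
  case False
  show ?thesis
    unfolding waiting_rule_def
    by (subst Least_Suc[where n="Suc n"])
      (use False in \<open>auto simp del: posterior.simps(2) simp: posterior_case_nat add_ac\<close>)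
qed

context house_selling
begin

text \<open>
  Both branches of the maximum in the value function are attained: stopping gives the left one,
  and waiting gives the right one by induction. Only the values of \<open>\<tau>\<close> on paths starting with
  \<open>x\<close> are constrained, which is what the sections in the induction provide.
\<close>

lemma value_of_waiting_rule:
  assumes "\<mu> \<in> space (prob_algebra T)" "\<tau> \<in> stopping_times n"
    and "\<And>\<omega>. \<tau> (case_nat x \<omega>) = waiting_rule lam q nu c U n k \<mu> (case_nat x \<omega>)"
  shows "value_of \<tau> x \<mu> (- (real k * c)) = V n x \<mu> (- (real k * c))"
  using assms
proof (induction n arbitrary: x \<mu> \<tau> k)
  case 0
  then show ?case
    using value_of_stop[OF 0(1,2)] by (simp add: waiting_rule_0)
next
  case (Suc n)
  note \<tau> = Suc.prems(3)[unfolded waiting_rule_Suc]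
  show ?case
  proof (cases "cont_val lam q nu c U (Suc n) \<mu> (- (real k * c)) \<le> ereal (U (x - real k * c))")
    case True
    then show ?thesis
      using value_of_stop[OF Suc.prems(1,2)] \<tau> by (simp add: cont_val_def max_def)
  next
    case False
    then have pos: "1 \<le> \<tau> (case_nat x \<omega>)" for \<omega> by (simp add: \<tau>)
    have shift: "- (real k * c) - c = - (real (Suc k) * c)" by (simp add: algebra_simps)
    have "value_of \<tau> x \<mu> (- (real k * c)) = cont n \<mu> (- (real k * c))"
      unfolding value_of_continue[OF Suc.prems(1,2) pos] next_value_def shift
    proof (intro ext_integral_cong Suc.IH update_prob Suc.prems(1) stopping_time_section[OF Suc.prems(2) pos])
      show "\<tau> (case_nat x (case_nat y \<omega>)) - 1 =
        waiting_rule lam q nu c U n (Suc k) (update q nu y \<mu>) (case_nat y \<omega>)" for y \<omega>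
        using False by (simp add: \<tau>)
    qed
    moreover have "ereal (U (x - real k * c)) \<le> cont n \<mu> (- (real k * c))"
      using False by (simp add: cont_val_def)
    ultimately show ?thesis by (simp add: max_absorb2)
  qed
qed

section \<open>Reservation levels\<close>

lemma shifted_util_strict_mono: "strict_mono (shifted_util c U n)"
  using U_strict_mono by (simp add: strict_mono_def shifted_util_def)

lemma range_shifted_util: "range (shifted_util c U n) = range U"
proof -
  have "U x = shifted_util c U n (x + real n * c)" for x by (simp add: shifted_util_def)
  then have "U x \<in> range (shifted_util c U n)" for x by (metis rangeI)
  then show ?thesis by (auto simp: shifted_util_def)
qed

lemma cont_val_range:
  assumes "\<mu> \<in> space (prob_algebra T)"
  shows "cont_val lam q nu c U m \<mu> s \<in> insert (-\<infinity>) (ereal ` range (shifted_util c U n))"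
  unfolding range_shifted_util cont_val_def by (rule val_cont_range(2)[OF assms])

lemma posterior_prob:
  "\<mu> \<in> space (prob_algebra T) \<Longrightarrow> posterior q nu \<mu> j \<omega> \<in> space (prob_algebra T)"
  by (induction j) (auto intro: update_prob)

text \<open>
  An offer reaches its reservation level exactly when its utility reaches the continuation
  value.
\<close>

lemma opt_stop_eq_waiting_rule:
  assumes "\<mu> \<in> space (prob_algebra T)"
  shows "opt_stop lam q nu c U \<mu> n \<omega> = waiting_rule lam q nu c U n 0 \<mu> \<omega>"
  unfolding opt_stop_def waiting_rule_def Inf_nat_def
  by (rule arg_cong[where f=Least])
    (auto simp: fun_eq_iff res_level_def ext_inv_le_iff[OF shifted_util_strict_mono cont_val_range[OF posterior_prob[OF assms]]]
      shifted_util_def)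

lemma posterior_measurable:
  assumes "\<mu> \<in> space (prob_algebra T)" "j \<le> t"
  shows "(\<lambda>\<omega>. posterior q nu \<mu> j \<omega>) \<in> offer_filtration t \<rightarrow>\<^sub>M prob_algebra T"
  using assms(2)
proof (induction j)
  case 0
  have "posterior q nu \<mu> 0 = (\<lambda>_. \<mu>)" by auto
  then show ?case using assms(1) by simp
next
  case (Suc j)
  then have [measurable]: "(\<lambda>\<omega>. \<omega> (Suc j)) \<in> offer_filtration t \<rightarrow>\<^sub>M borel"
    "(\<lambda>\<omega>. posterior q nu \<mu> j \<omega>) \<in> offer_filtration t \<rightarrow>\<^sub>M prob_algebra T"
    by (auto intro: measurable_coordinate_filtration)
  show ?case unfolding posterior.simps by measurable
qed

text \<open>
  Whether the level is reached at time \<open>j\<close> depends on the offer and the filter at time \<open>j\<close>, both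
  of which are known then.
\<close>

lemma opt_stop_stopping_time:
  assumes \<mu>: "\<mu> \<in> space (prob_algebra T)"
  shows "opt_stop lam q nu c U \<mu> n \<in> stopping_times n"
  unfolding stopping_times_def
proof (intro CollectI conjI allI stopping_timeI)
  define P where "P j \<omega> \<longleftrightarrow> j = n \<or> j < n \<and>
       cont_val lam q nu c U (n - j) (posterior q nu \<mu> j \<omega>) (- (real j * c))
         \<le> ereal (U (\<omega> j - real j * c))" for j \<omega>
  have rule: "opt_stop lam q nu c U \<mu> n \<omega> = (LEAST j. P j \<omega>)" for \<omega>
    by (simp add: opt_stop_eq_waiting_rule[OF \<mu>] waiting_rule_def P_def)
  have Pn: "P n \<omega>" for \<omega> by (simp add: P_def)
  show "opt_stop lam q nu c U \<mu> n \<omega> \<le> n" for \<omega>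
    unfolding rule by (rule Least_le[of "\<lambda>j. P j \<omega>" n, OF Pn])
  fix t
  have "opt_stop lam q nu c U \<mu> n \<omega> \<le> t \<longleftrightarrow> (\<exists>j\<in>{..t}. P j \<omega>)" for \<omega>
    unfolding rule using LeastI[of "\<lambda>j. P j \<omega>", OF Pn] Least_le[of "\<lambda>j. P j \<omega>"]
    by (auto intro: order_trans)
  moreover have "Measurable.pred (offer_filtration t) (\<lambda>\<omega>. \<exists>j\<in>{..t}. P j \<omega>)"
  proof (intro pred_intros_finite)
    fix j assume "j \<in> {..t}"
    then have [measurable]: "(\<lambda>\<omega>. \<omega> j) \<in> offer_filtration t \<rightarrow>\<^sub>M borel"
      "posterior q nu \<mu> j \<in> offer_filtration t \<rightarrow>\<^sub>M prob_algebra T"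
      by (auto intro: measurable_coordinate_filtration posterior_measurable[OF \<mu>])
    define f where "f \<omega> = cont_val lam q nu c U (n - j) (posterior q nu \<mu> j \<omega>) (- (real j * c))" for \<omega>
    define g where "g \<omega> = ereal (U (\<omega> j - real j * c))" for \<omega> :: "nat \<Rightarrow> real"
    have f: "f \<in> borel_measurable (offer_filtration t)"
      unfolding f_def[abs_def] cont_val_def by (rule cont_measurable) measurable
    have g: "g \<in> borel_measurable (offer_filtration t)"
      unfolding g_def[abs_def] by measurable
    have "Measurable.pred (offer_filtration t) (\<lambda>\<omega>. f \<omega> \<le> g \<omega>)"
      using borel_measurable_le[OF f g] by (simp add: pred_def)
    then show "Measurable.pred (offer_filtration t) (\<lambda>\<omega>. P j \<omega>)"
      unfolding P_def f_def g_def by (intro pred_intros_logic) simp_all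
  qed simp
  ultimately show "Measurable.pred (offer_filtration t) (\<lambda>\<omega>. opt_stop lam q nu c U \<mu> n \<omega> \<le> t)"
    by simp
qed

lemma reward_eq_value_of:
  assumes \<mu>: "\<mu> \<in> space (prob_algebra T)" and \<tau>: "\<tau> \<in> stopping_times n"
  shows "reward lam q c U \<mu> x \<tau> = value_of \<tau> x \<mu> 0"
proof -
  have [measurable_cong]: "sets \<mu> = sets T" using \<mu> by (simp add: space_prob_algebra)
  have "path_measure lam q x \<in> \<mu> \<rightarrow>\<^sub>M subprob_algebra paths"
    by (rule measurable_prob_algebraD) measurable
  note bind = ext_integral_bind[OF this payoff_measurable[OF \<tau>, of 0]]
  have "(\<integral>\<^sup>+ \<omega>. e2ennreal (payoff \<tau> 0 \<omega>) \<partial>(\<mu> \<bind> path_measure lam q x)) < \<infinity>"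
    unfolding path_mix_def[symmetric]
    by (rule payoff_finite[OF \<mu>, where n=n]) (use \<tau> in \<open>auto simp: stopping_times_def\<close>)
  from bind[OF this] show ?thesis
    by (simp add: reward_def value_of_def path_mix_def payoff_def[abs_def])
qed

theorem opt_stop_optimal:
  assumes \<mu>: "\<mu> \<in> space (prob_algebra T)"
  shows "reward lam q c U \<mu> x (opt_stop lam q nu c U \<mu> n) = opt_reward lam q c U \<mu> n x"
    (is "reward lam q c U \<mu> x ?\<tau> = _")
proof (rule antisym)
  have \<tau>: "?\<tau> \<in> stopping_times n" by (rule opt_stop_stopping_time[OF \<mu>])
  then show "reward lam q c U \<mu> x ?\<tau> \<le> opt_reward lam q c U \<mu> n x"
    unfolding opt_reward_def by (rule SUP_upper)
  have "value_of ?\<tau> x \<mu> 0 = V n x \<mu> 0"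
    using value_of_waiting_rule[OF \<mu> \<tau>, of x 0] by (simp add: opt_stop_eq_waiting_rule[OF \<mu>])
  then show "opt_reward lam q c U \<mu> n x \<le> reward lam q c U \<mu> x ?\<tau>"
    unfolding opt_reward_def reward_eq_value_of[OF \<mu> \<tau>]
    by (auto intro!: SUP_least simp: reward_eq_value_of[OF \<mu>] value_of_le_val[OF \<mu>])
qed

lemma res_level_last:
  assumes "1 \<le> n"
  shows "res_level lam q nu c U n (n - 1) \<mu> =
    ext_inv (shifted_util c U (n - 1))
      (ext_integral (mix_dist lam q \<mu>) (\<lambda>y. ereal (shifted_util c U n y)))"
  using assms by (simp add: res_level_def cont_val_def next_value_def shifted_util_def of_nat_diff algebra_simps)

text \<open>
  Since \<open>U\<close>, shifted by the cost, is increasing, the maximum of a utility and a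
  continuation value is the utility of the maximum of the offer and the reservation level.
\<close>

lemma res_level_step:
  assumes \<mu>: "\<mu> \<in> space (prob_algebra T)" and n: "n + 2 \<le> m"
  shows "res_level lam q nu c U m n \<mu> =
    ext_inv (shifted_util c U n) (ext_integral (mix_dist lam q \<mu>)
      (\<lambda>y. ext_fun (shifted_util c U (n + 1))
        (max (ereal y) (res_level lam q nu c U m (n + 1) (update q nu y \<mu>)))))"
proof -
  obtain k where k: "m = Suc (Suc (n + k))"
    using n by (auto simp: le_iff_add)
  have shift: "- (real n * c) - c = - (real (n + 1) * c)" by (simp add: algebra_simps)
  have "V (Suc k) y (update q nu y \<mu>) (- (real (n + 1) * c)) =
    ext_fun (shifted_util c U (n + 1)) (max (ereal y) (res_level lam q nu c U m (n + 1) (update q nu y \<mu>)))" for y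
    unfolding res_level_def
    by (subst ext_fun_max_ext_inv[OF shifted_util_strict_mono cont_val_range[OF update_prob[OF \<mu>]]])
      (simp add: k cont_val_def shifted_util_def)
  then show ?thesis
    by (simp add: res_level_def[of _ _ _ _ _ _ n] cont_val_def k next_value_def[of _ _ _ _ "V (Suc k)"] shift del: val.simps)
qed

end

theorem theorem4p1:
  fixes \<Theta> :: "'t :: polish_space set"
    and lam :: "real measure"
    and q :: "real \<Rightarrow> 't \<Rightarrow> real"
    and Q0 nu :: "'t measure"
    and c :: real
    and U :: "real \<Rightarrow> real"
    and N :: nat
  assumes "\<Theta> \<in> sets borel"
    and "sets lam = sets borel" and "sigma_finite_measure lam"
    and "(\<lambda>(y, \<theta>). q y \<theta>) \<in> borel_measurable (borel \<Otimes>\<^sub>M restrict_space borel \<Theta>)"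
    and "\<And>y \<theta>. \<theta> \<in> \<Theta> \<Longrightarrow> q y \<theta> \<ge> 0"
    and "\<And>\<theta>. \<theta> \<in> \<Theta> \<Longrightarrow> prob_space (offer_dist lam q \<theta>)"
    and "Q0 \<in> space (prob_algebra (restrict_space borel \<Theta>))"
    and "nu \<in> space (prob_algebra (restrict_space borel \<Theta>))"
    and "c > 0"
    and "strict_mono U" and "concave_on UNIV U"
    and "(SUP \<theta>\<in>\<Theta>. \<integral>\<^sup>+ y. ennreal (max y 0) \<partial>offer_dist lam q \<theta>) < \<infinity>"
  shows
    "(\<forall>x. opt_stop lam q nu c U Q0 N \<in> stopping_times N \<and>
          reward lam q c U Q0 x (opt_stop lam q nu c U Q0 N) = opt_reward lam q c U Q0 N x) \<and>
     (\<forall>\<mu>\<in>space (prob_algebra (restrict_space borel \<Theta>)).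
       (N \<ge> 1 \<longrightarrow>
          res_level lam q nu c U N (N - 1) \<mu> =
            ext_inv (shifted_util c U (N - 1))
              (ext_integral (mix_dist lam q \<mu>) (\<lambda>y. ereal (shifted_util c U N y)))) \<and>
       (\<forall>n. n + 2 \<le> N \<longrightarrow>
          res_level lam q nu c U N n \<mu> =
            ext_inv (shifted_util c U n)
              (ext_integral (mix_dist lam q \<mu>)
                (\<lambda>y. ext_fun (shifted_util c U (n + 1))
                   (max (ereal y) (res_level lam q nu c U N (n + 1) (update q nu y \<mu>)))))))"
proof -
  have sp: "space (restrict_space borel \<Theta>) = \<Theta>" by (simp add: space_restrict_space)
  let ?K = "SUP \<theta>\<in>\<Theta>. \<integral>\<^sup>+ y. ennreal (max y 0) \<partial>offer_dist lam q \<theta>"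
  have "prob_space (offer_dist lam q \<theta>)" "(\<integral>\<^sup>+ y. ennreal (max y 0) \<partial>offer_dist lam q \<theta>) \<le> ?K"
    if "\<theta> \<in> space (restrict_space borel \<Theta>)" for \<theta>
    using that assms(6) unfolding sp by (auto intro: SUP_upper)
  then interpret house_selling "restrict_space borel \<Theta>" lam q nu c U ?K
    using assms by (intro house_selling.intro bayes_model.intro house_selling_axioms.intro)
  show ?thesis
  proof (intro conjI ballI allI impI)
    fix x
    show "opt_stop lam q nu c U Q0 N \<in> stopping_times N"
      by (rule opt_stop_stopping_time[OF assms(7)])
    show "reward lam q c U Q0 x (opt_stop lam q nu c U Q0 N) = opt_reward lam q c U Q0 N x"
      by (rule opt_stop_optimal[OF assms(7)])
  qed (rule res_level_last res_level_step; assumption)+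
qed

end
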